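(* The blockwise GIGO algorithm in $\mathbb{G}_d$ with splitting $\Phi: \mathcal{N} (\mu, \Sigma) \mapsto (\mu, \Sigma)$, sample size $N$, step sizes $\delta t_{\mu}, \delta t_{\Sigma}$ and selection scheme $w$ coincides with the xNES algorithm with sample size $N$, weights $w_{i}$ (those determined by $w$), and learning rates $\eta_{\mu}=\delta t_{\mu}$ and $\eta_{\sigma}=\eta_{B}=\eta_\Sigma=\delta t_{\Sigma}$. That is, for the same current distribution $\mathcal N(\mu,\Sigma)$, with $\Sigma=AA^T$, and the same sampled points $x_1,\dots,x_N$, the two update rules produce the same new Gaussian distribution.
   Context: **Manifold.** $\mathbb{G}_d$ is the manifold of nondegenerate Gaussian distributions on $\mathbb{R}^d$ with the Fisher metric: the squared norm of $(\dot\mu,\dot\Sigma)$ at $\mathcal N(\mu,\Sigma)$ is $\dot\mu^T\Sigma^{-1}\dot\mu+\frac12\operatorname{tr}(\dot\Sigma\Sigma^{-1}\dot\Sigma\Sigma^{-1})$. **Weights.** One minimizes $f:\mathbb{R}^d\to\mathbb{R}$. A selection scheme is a non-increasing function $w:[0,1]\to\mathbb{R}$. Given points $x_1,\dots,x_N$ (sampled from the current distribution), without ties and numbered so that $f(x_1)<\dots<f(x_N)$, put $\mathrm{rk}(x_i)=|\{j: f(x_j)<f(x_i)\}|=i-1$ and $w_i=\hat w_i=\frac1N w\left(\frac{\mathrm{rk}(x_i)+1/2}{N}\right)$. **Blockwise GIGO.** A splitting of a Riemannian manifold $\Theta$ is a diffeomorphism $\Theta\cong\Theta_1\times\dots\times\Theta_n$;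 it is compatible if at each point the tangent spaces of the factors are pairwise orthogonal. For $\theta=(\theta_1,\dots,\theta_n)\in\Theta$, let $\Theta_{\theta,i}=\{\theta_1\}\times\dots\times\{\theta_{i-1}\}\times\Theta_i\times\{\theta_{i+1}\}\times\dots\times\{\theta_n\}$ with the metric induced from $\Theta$, and let $\Phi_{\theta,i}$ be the Riemannian exponential at $\theta$ of $\Theta_{\theta,i}$. For a family of distributions $(P_\theta)$ with Fisher information matrix $I(\theta)$, the blockwise GIGO algorithm for a compatible splitting, with step sizes $\delta t_1,\dots,\delta t_n$, updates $\theta=\theta^t$ to $(\theta_1^{t+\delta t_1},\dots,\theta_n^{t+\delta t_n})$, where $Y=I^{-1}(\theta^t)\sum_{i=1}^N\hat w_i\frac{\partial\ln P_\theta(x_i)}{\partial\theta}\big|_{\theta=\theta^t}$, $Y_i$ is the $T\Theta_{\theta^t,i}$-component of $Y$, and $\theta_i^{t+\delta t_i}$ is the $i$-th component of $\Phi_{\theta^t,i}(\delta t_i Y_i)$. Here $n=2$, $\Theta_1=\mathbb{R}^d$ (means, step size $\delta t_\mu$), $\Theta_2$ = symmetric positive definite $d\times d$ matrices (covariances, step size $\delta t_\Sigma$). **xNES.** With learning rates $\eta_\mu$ and $\eta_\Sigma$ (the case in which the two covariance learning rates $\eta_\sigma,\eta_B$ of general xNES are both equal to $\eta_\Sigma$), xNES maintains $\mu\in\mathbb{R}^d$ and an invertible $A$, samples $x_1,\dots,x_N$ from $\mathcal N(\mu,AA^T)$ (numbered so that $f(x_1)<\dots<f(x_N)$), sets $z_i=A^{-1}(x_i-\mu)$,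 $G_\mu=\sum_{i=1}^N w_iz_i$, $G_M=\sum_{i=1}^N w_i(z_iz_i^T-I)$, and updates $\mu\leftarrow\mu+\eta_\mu AG_\mu$, $A\leftarrow A\exp(\eta_\Sigma G_M/2)$; its new distribution is $\mathcal N(\mu,AA^T)$ for the updated $\mu,A$. *)

theory Defs
  imports "HOL-Analysis.Analysis"
begin

section \<open>Riemannian manifolds in a global chart\<close>

text \<open>
  A Riemannian manifold covered by a single chart is given by a set \<open>M\<close> that is relatively open in
  a translate of a linear subspace \<open>T\<close> of a normed space (so that every tangent space is \<open>T\<close>) and a
  metric \<open>g\<close>, where \<open>g p u v\<close> is the inner product of \<open>u, v \<in> T\<close> at \<open>p \<in> M\<close>.  The submanifold
  obtained by intersecting \<open>M\<close> with a translate of a smaller subspace carries the induced metric,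
  which is again \<open>g\<close>, now used on the smaller tangent space only.
\<close>

definition dir_deriv :: "('a::real_normed_vector \<Rightarrow> real) \<Rightarrow> 'a \<Rightarrow> 'a \<Rightarrow> real" where
  "dir_deriv F p h = deriv (\<lambda>t::real. F (p + t *\<^sub>R h)) 0"

text \<open>
  Christoffel symbol of the first kind of the Levi-Civita connection: by the Koszul formula for
  constant (hence commuting) vector fields, it is the inner product of \<open>\<nabla>\<^sub>u v\<close> with \<open>h\<close> at \<open>p\<close>.
\<close>

definition christoffel ::
  "('a::real_normed_vector \<Rightarrow> 'a \<Rightarrow> 'a \<Rightarrow> real) \<Rightarrow> 'a \<Rightarrow> 'a \<Rightarrow> 'a \<Rightarrow> 'a \<Rightarrow> real" where
  "christoffel g p u v h =
     (dir_deriv (\<lambda>q. g q v h) p u + dir_deriv (\<lambda>q. g q u h) p v - dir_deriv (\<lambda>q. g q u v) p h) / 2"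

text \<open>
  \<open>\<gamma>\<close> is a geodesic on \<open>[0, 1]\<close> with initial velocity \<open>v\<close>: the covariant derivative of its velocity
  is orthogonal to all tangent vectors.
\<close>

definition geodesic_from ::
  "'a::real_normed_vector set \<Rightarrow> 'a set \<Rightarrow> ('a \<Rightarrow> 'a \<Rightarrow> 'a \<Rightarrow> real) \<Rightarrow> 'a \<Rightarrow> 'a \<Rightarrow> (real \<Rightarrow> 'a) \<Rightarrow> bool"
where
  "geodesic_from M T g p v \<gamma> \<longleftrightarrow>
     \<gamma> 0 = p \<and>
     (\<exists>\<gamma>' \<gamma>''. \<gamma>' 0 = v \<and>
        (\<forall>t\<in>{0..1}. \<gamma> t \<in> M \<and>
           (\<gamma> has_vector_derivative \<gamma>' t) (at t within {0..1}) \<and>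
           (\<gamma>' has_vector_derivative \<gamma>'' t) (at t within {0..1}) \<and>
           (\<forall>h\<in>T. g (\<gamma> t) (\<gamma>'' t) h + christoffel g (\<gamma> t) (\<gamma>' t) (\<gamma>' t) h = 0)))"

definition riemannian_exp ::
  "'a::real_normed_vector set \<Rightarrow> 'a set \<Rightarrow> ('a \<Rightarrow> 'a \<Rightarrow> 'a \<Rightarrow> real) \<Rightarrow> 'a \<Rightarrow> 'a \<Rightarrow> 'a" where
  "riemannian_exp M T g p v = (THE q. \<exists>\<gamma>. geodesic_from M T g p v \<gamma> \<and> \<gamma> 1 = q)"


section \<open>Natural gradient\<close>

text \<open>
  A family of distributions is given by its densities with respect to Lebesgue measure: \<open>P \<theta> x\<close> is
  the density at \<open>x\<close> of the distribution with parameter \<open>\<theta>\<close>.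
\<close>

definition distr_of :: "('a \<Rightarrow> 'x::euclidean_space \<Rightarrow> real) \<Rightarrow> 'a \<Rightarrow> 'x measure" where
  "distr_of P \<theta> = density lborel (\<lambda>x. ennreal (P \<theta> x))"

definition score ::
  "('a::real_normed_vector \<Rightarrow> 'x \<Rightarrow> real) \<Rightarrow> 'a \<Rightarrow> 'x \<Rightarrow> 'a \<Rightarrow> real" where
  "score P \<theta> x h = dir_deriv (\<lambda>q. ln (P q x)) \<theta> h"

text \<open>
  The Fisher information as a bilinear form; its values on pairs of vectors of a basis of the tangent
  space are the entries of the Fisher information matrix in the corresponding coordinates.
\<close>

definition fisher_information ::
  "('a::real_normed_vector \<Rightarrow> 'x::euclidean_space \<Rightarrow> real) \<Rightarrow> 'a \<Rightarrow> 'a \<Rightarrow> 'a \<Rightarrow> real" where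
  "fisher_information P \<theta> u v = (\<integral>x. score P \<theta> x u * score P \<theta> x v \<partial>distr_of P \<theta>)"

text \<open>
  \<open>I\<inverse>(\<theta>) (\<Sum>i. \<omega>\<^sub>i \<partial> ln P\<^sub>\<theta>(x\<^sub>i) / \<partial>\<theta>)\<close>: the tangent vector \<open>Y\<close> for which \<open>I(\<theta>) Y\<close> is the given
  covector.
\<close>

definition natural_gradient ::
  "('a::real_normed_vector \<Rightarrow> 'x::euclidean_space \<Rightarrow> real) \<Rightarrow> 'a set \<Rightarrow> nat \<Rightarrow> (nat \<Rightarrow> real) \<Rightarrow>
   (nat \<Rightarrow> 'x) \<Rightarrow> 'a \<Rightarrow> 'a" where
  "natural_gradient P T N \<omega> x \<theta> =
     (THE Y. Y \<in> T \<and> (\<forall>h\<in>T. fisher_information P \<theta> Y h = (\<Sum>i=1..N. \<omega> i * score P \<theta> (x i) h)))"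


section \<open>Blockwise GIGO for a splitting into two factors\<close>

definition compatible_splitting ::
  "('a::real_normed_vector \<times> 'b::real_normed_vector \<Rightarrow> 'a \<times> 'b \<Rightarrow> 'a \<times> 'b \<Rightarrow> real) \<Rightarrow>
   'a set \<Rightarrow> 'a set \<Rightarrow> 'b set \<Rightarrow> 'b set \<Rightarrow> bool" where
  "compatible_splitting g M1 T1 M2 T2 \<longleftrightarrow>
     (\<forall>p \<in> M1 \<times> M2. \<forall>u\<in>T1. \<forall>v\<in>T2. g p (u, 0) (0, v) = 0)"

definition selection_weight ::
  "('x \<Rightarrow> real) \<Rightarrow> (real \<Rightarrow> real) \<Rightarrow> nat \<Rightarrow> (nat \<Rightarrow> 'x) \<Rightarrow> nat \<Rightarrow> real" where
  "selection_weight f w N x i =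
     (let rk = card {j \<in> {1..N}. f (x j) < f (x i)} in w ((real rk + 1/2) / real N) / real N)"

definition blockwise_gigo ::
  "('a::real_normed_vector \<times> 'b::real_normed_vector \<Rightarrow> 'x::euclidean_space \<Rightarrow> real) \<Rightarrow>
   ('a \<times> 'b \<Rightarrow> 'a \<times> 'b \<Rightarrow> 'a \<times> 'b \<Rightarrow> real) \<Rightarrow> 'a set \<Rightarrow> 'a set \<Rightarrow> 'b set \<Rightarrow> 'b set \<Rightarrow>
   ('x \<Rightarrow> real) \<Rightarrow> (real \<Rightarrow> real) \<Rightarrow> nat \<Rightarrow> (nat \<Rightarrow> 'x) \<Rightarrow> real \<Rightarrow> real \<Rightarrow> 'a \<times> 'b \<Rightarrow> 'a \<times> 'b" where
  "blockwise_gigo P g M1 T1 M2 T2 f w N x \<delta>1 \<delta>2 \<theta> =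
     (let Y = natural_gradient P (T1 \<times> T2) N (selection_weight f w N x) x \<theta> in
       (fst (riemannian_exp (M1 \<times> {snd \<theta>}) (T1 \<times> {0}) g \<theta> (\<delta>1 *\<^sub>R (fst Y, 0))),
        snd (riemannian_exp ({fst \<theta>} \<times> M2) ({0} \<times> T2) g \<theta> (\<delta>2 *\<^sub>R (0, snd Y)))))"


section \<open>The manifold of nondegenerate Gaussian distributions\<close>

definition sym_matrices :: "(real^'d^'d) set" where
  "sym_matrices = {S. transpose S = S}"

definition spd_matrices :: "(real^'d^'d) set" where
  "spd_matrices = {S. transpose S = S \<and> (\<forall>v. v \<noteq> 0 \<longrightarrow> 0 < v \<bullet> (S *v v))}"

definition gaussian_density :: "(real^'d) \<times> (real^'d^'d) \<Rightarrow> real^'d \<Rightarrow> real" where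
  "gaussian_density = (\<lambda>(\<mu>, \<Sigma>) x.
     exp (- ((x - \<mu>) \<bullet> (matrix_inv \<Sigma> *v (x - \<mu>))) / 2) / sqrt ((2 * pi) ^ CARD('d) * det \<Sigma>))"

abbreviation gaussian :: "(real^'d) \<times> (real^'d^'d) \<Rightarrow> (real^'d) measure" where
  "gaussian \<equiv> distr_of gaussian_density"

text \<open>The polarization of \<open>\<mu>\<^sup>T \<Sigma>\<inverse> \<mu> + tr (S \<Sigma>\<inverse> S \<Sigma>\<inverse>) / 2\<close> for a tangent vector \<open>(\<mu>, S)\<close>.\<close>

definition gaussian_fisher_metric ::
  "(real^'d) \<times> (real^'d^'d) \<Rightarrow> (real^'d) \<times> (real^'d^'d) \<Rightarrow> (real^'d) \<times> (real^'d^'d) \<Rightarrow> real" where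
  "gaussian_fisher_metric \<theta> u v =
     (let P = matrix_inv (snd \<theta>) in
       fst u \<bullet> (P *v fst v) + trace (snd u ** P ** snd v ** P) / 2)"

lemma gaussian_splitting_compatible:
  "compatible_splitting gaussian_fisher_metric UNIV UNIV spd_matrices sym_matrices"
  by (simp add: compatible_splitting_def gaussian_fisher_metric_def Let_def trace_def
      matrix_matrix_mult_def)

definition gaussian_blockwise_gigo ::
  "(real^'d \<Rightarrow> real) \<Rightarrow> (real \<Rightarrow> real) \<Rightarrow> nat \<Rightarrow> (nat \<Rightarrow> real^'d) \<Rightarrow> real \<Rightarrow> real \<Rightarrow>
   (real^'d) \<times> (real^'d^'d) \<Rightarrow> (real^'d) \<times> (real^'d^'d)" where
  "gaussian_blockwise_gigo =
     blockwise_gigo gaussian_density gaussian_fisher_metric UNIV UNIV spd_matrices sym_matrices"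


section \<open>xNES\<close>

definition matrix_exp :: "real^'d^'d \<Rightarrow> real^'d^'d" where
  "matrix_exp X = (\<Sum>k. (1 / fact k) *\<^sub>R (((**) X ^^ k) (mat 1)))"

definition xnes_step ::
  "nat \<Rightarrow> (nat \<Rightarrow> real) \<Rightarrow> (nat \<Rightarrow> real^'d) \<Rightarrow> real \<Rightarrow> real \<Rightarrow>
   (real^'d) \<times> (real^'d^'d) \<Rightarrow> (real^'d) \<times> (real^'d^'d)" where
  "xnes_step N \<omega> x \<eta>\<mu> \<eta>\<Sigma> = (\<lambda>(\<mu>, A).
     let z = (\<lambda>i. matrix_inv A *v (x i - \<mu>));
         G\<mu> = (\<Sum>i=1..N. \<omega> i *\<^sub>R z i);
         GM = (\<Sum>i=1..N. \<omega> i *\<^sub>R ((\<chi> j k. z i $ j * z i $ k) - mat 1))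
     in (\<mu> + \<eta>\<mu> *\<^sub>R (A *v G\<mu>), A ** matrix_exp ((\<eta>\<Sigma> / 2) *\<^sub>R GM)))"

end

theory Submission
  imports Defs "HOL-Probability.Distributions"
begin

text \<open>Write \<open>\<Sigma> = A A\<^sup>T\<close> and use whitened coordinates: a point \<open>x\<close> becomes \<open>z = A\<inverse> (x - \<mu>)\<close>, a tangent
  vector \<open>(u, S)\<close> becomes \<open>a = A\<inverse> u\<close> and the symmetric matrix \<open>B = A\<inverse> S A\<^sup>-\<^sup>T\<close>.  Then the score at
  \<open>x\<close> is \<open>a \<bullet> z + (z\<^sup>T B z - tr B) / 2\<close> (\<open>score_gaussian\<close>), and under the current distribution \<open>z\<close>
  is standard Gaussian, so moments up to order four give the Fisher form
  \<open>a \<bullet> a' + tr (B B') / 2\<close> (\<open>fisher_information_gaussian\<close>).  Comparing this form with the weighted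
  sum of the scores, the natural gradient in whitened coordinates is \<open>(G\<^sub>\<mu>, G\<^sub>M)\<close>, exactly the pair
  of quantities that xNES forms from its samples; in the original coordinates it is
  \<open>(A G\<^sub>\<mu>, A G\<^sub>M A\<^sup>T)\<close> (\<open>natural_gradient_gaussian\<close>).

  It remains to compute the two block exponentials.  With \<open>\<Sigma>\<close> fixed the metric does not depend on
  the point, so geodesics are straight lines and the mean moves to \<open>\<mu> + \<delta>t\<^sub>\<mu> A G\<^sub>\<mu>\<close>
  (\<open>riemannian_exp_mean\<close>).  With \<open>\<mu>\<close> fixed the geodesic equation is \<open>\<Sigma>'' = \<Sigma>' \<Sigma>\<inverse> \<Sigma>'\<close>.  It says that
  \<open>\<Sigma>\<inverse> \<Sigma>'\<close> is constant, hence is a linear equation in disguise, and its solution is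
  \<open>A exp (t \<delta>t\<^sub>\<Sigma> G\<^sub>M) A\<^sup>T\<close> (\<open>riemannian_exp_cov\<close>).  Since \<open>G\<^sub>M\<close> is symmetric,
  \<open>exp (\<delta>t\<^sub>\<Sigma> G\<^sub>M)\<close> is \<open>E E\<^sup>T\<close> for \<open>E = exp (\<delta>t\<^sub>\<Sigma> G\<^sub>M / 2)\<close>, so the endpoint is \<open>A' A'\<^sup>T\<close> for the xNES
  matrix \<open>A' = A E\<close>.

  The exponential and the natural gradient are defined by unique existence, so in each case both a
  solution and its uniqueness are established.\<close>

section \<open>Matrix algebra\<close>

lemma matrix_inv_right: "invertible A \<Longrightarrow> A ** matrix_inv A = mat 1"
  and matrix_inv_left: "invertible A \<Longrightarrow> matrix_inv A ** A = mat 1"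
  for A :: "real^'n^'n"
  unfolding invertible_def matrix_inv_def by (metis (mono_tags, lifting) someI_ex)+

lemma matrix_inv_unique:
  fixes A B :: "real^'n^'n"
  assumes "A ** B = mat 1"
  shows "matrix_inv A = B"
proof -
  have "invertible A" using assms matrix_left_right_inverse[of A B] unfolding invertible_def by blast
  then have "matrix_inv A = matrix_inv A ** (A ** B)" using assms by simp
  also have "\<dots> = B" using \<open>invertible A\<close> by (simp only: matrix_mul_assoc matrix_inv_left matrix_mul_lid)
  finally show ?thesis .
qed

lemma matrix_inv_mult:
  fixes A B :: "real^'n^'n"
  assumes "invertible A" "invertible B"
  shows "matrix_inv (A ** B) = matrix_inv B ** matrix_inv A"
proof (rule matrix_inv_unique)
  have "A ** B ** (matrix_inv B ** matrix_inv A) = A ** (B ** matrix_inv B) ** matrix_inv A"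
    by (simp only: matrix_mul_assoc)
  then show "A ** B ** (matrix_inv B ** matrix_inv A) = mat 1"
    by (simp add: matrix_inv_right assms)
qed

lemma matrix_inv_transpose:
  fixes A :: "real^'n^'n"
  assumes "invertible A"
  shows "matrix_inv (transpose A) = transpose (matrix_inv A)"
  by (rule matrix_inv_unique)
    (simp add: matrix_transpose_mul[symmetric] matrix_inv_left assms)

lemma inner_matrix_vector_transpose:
  fixes M :: "real^'n^'m"
  shows "(M *v a) \<bullet> b = a \<bullet> (transpose M *v b)"
  by (metis dot_lmul_matrix inner_commute transpose_matrix_vector)

lemma quadratic_form_congruence:
  fixes C M :: "real^'n^'n"
  shows "v \<bullet> ((C ** M ** transpose C) *v w) = (transpose C *v v) \<bullet> (M *v (transpose C *v w))"
  by (metis inner_matrix_vector_transpose matrix_vector_mul_assoc transpose_transpose)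

lemma spd_matrices_congruence:
  fixes B :: "real^'n^'n"
  assumes "invertible B"
  shows "B ** transpose B \<in> spd_matrices"
proof -
  have "0 < v \<bullet> ((B ** transpose B) *v v)" if "v \<noteq> 0" for v
  proof -
    have "invertible (transpose B)" using assms by (rule transpose_invertible)
    then have "transpose B *v v \<noteq> 0"
      using that inj_matrix_vector_mult[of "transpose B"]
      by (metis inj_eq matrix_vector_mult_0_right)
    moreover have "v \<bullet> ((B ** transpose B) *v v) = (transpose B *v v) \<bullet> (transpose B *v v)"
      by (metis inner_matrix_vector_transpose matrix_vector_mul_assoc transpose_transpose)
    ultimately show ?thesis by simp
  qed
  then show ?thesis by (simp add: spd_matrices_def matrix_transpose_mul)
qed

lemma spd_matrices_invertible:
  fixes S :: "real^'n^'n"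
  assumes "S \<in> spd_matrices"
  shows "invertible S"
proof -
  have "S *v v \<noteq> 0" if "v \<noteq> 0" for v
    using assms that by (force simp: spd_matrices_def)
  then show ?thesis
    unfolding invertible_left_inverse matrix_left_invertible_ker by blast
qed

text \<open>The trace pairing \<open>(X, H) \<mapsto> tr (X H)\<close> is nondegenerate on symmetric matrices because
  \<open>tr (X X)\<close> is the sum of the squares of the entries of \<open>X\<close>.\<close>

lemma trace_mult_self_symmetric:
  fixes X :: "real^'n^'n"
  assumes "transpose X = X"
  shows "trace (X ** X) = X \<bullet> X"
proof -
  have "X $ i $ j = X $ j $ i" for i j
    using assms by (metis transpose_def vec_lambda_beta)
  then show ?thesis
    by (simp add: trace_def matrix_matrix_mult_def inner_vec_def)
qed

lemma transpose_diff: "transpose (X - Y) = transpose X - transpose Y" for X Y :: "real^'n^'n"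
  by (simp add: transpose_def vec_eq_iff)

lemma linear_trace: "linear (trace :: real^'n^'n \<Rightarrow> real)"
  by (rule linearI) (simp_all add: trace_def sum.distrib sum_distrib_left)

lemma trace_scaleR: "trace (c *\<^sub>R X) = c * trace X" for X :: "real^'n^'n"
  by (simp add: trace_def sum_distrib_left)

section \<open>Matrix calculus\<close>

lemma bounded_bilinear_matrix_mult:
  "bounded_bilinear ((**) :: real^'n^'m \<Rightarrow> real^'p^'n \<Rightarrow> real^'p^'m)"
  unfolding bilinear_conv_bounded_bilinear[symmetric] bilinear_def
  by (auto intro!: linearI simp: matrix_matrix_mult_def vec_eq_iff algebra_simps sum.distrib sum_distrib_left)

lemmas matrix_mult_simps =
  bounded_bilinear.add_left[OF bounded_bilinear_matrix_mult]
  bounded_bilinear.add_right[OF bounded_bilinear_matrix_mult]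
  bounded_bilinear.diff_left[OF bounded_bilinear_matrix_mult]
  bounded_bilinear.diff_right[OF bounded_bilinear_matrix_mult]
  bounded_bilinear.minus_left[OF bounded_bilinear_matrix_mult]
  bounded_bilinear.minus_right[OF bounded_bilinear_matrix_mult]
  bounded_bilinear.scaleR_left[OF bounded_bilinear_matrix_mult]
  bounded_bilinear.scaleR_right[OF bounded_bilinear_matrix_mult]
  bounded_bilinear.zero_left[OF bounded_bilinear_matrix_mult]
  bounded_bilinear.zero_right[OF bounded_bilinear_matrix_mult]

lemma has_vector_derivative_matrix_mult:
  fixes F :: "real \<Rightarrow> real^'n^'m" and G :: "real \<Rightarrow> real^'p^'n"
  assumes "(F has_vector_derivative F') (at t within S)"
    and "(G has_vector_derivative G') (at t within S)"
  shows "((\<lambda>t. F t ** G t) has_vector_derivative F t ** G' + F' ** G t) (at t within S)"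
  by (rule bounded_bilinear.has_vector_derivative[OF bounded_bilinear_matrix_mult assms])

lemma tendsto_det:
  fixes f :: "'a \<Rightarrow> real^'n^'n"
  assumes "(f \<longlongrightarrow> A) F"
  shows "((\<lambda>t. det (f t)) \<longlongrightarrow> det A) F"
  unfolding det_def by (intro tendsto_intros assms)

text \<open>Cramer's rule makes the entries of the inverse quotients of polynomials in the entries of the
  matrix, whence inversion is continuous.\<close>

lemma matrix_inv_cramer:
  fixes A :: "real^'n^'n"
  assumes "det A \<noteq> 0"
  shows "matrix_inv A = (\<chi> k l. det (\<chi> i j. if j = k then axis l 1 $ i else A $ i $ j) / det A)"
proof -
  have "invertible A" using assms invertible_det_nz by blast
  then have "A *v (matrix_inv A *v b) = b" for b
    by (simp add: matrix_vector_mul_assoc matrix_inv_right)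
  then have "matrix_inv A *v axis l 1 = (\<chi> k. det (\<chi> i j. if j = k then axis l 1 $ i else A $ i $ j) / det A)" for l
    using cramer[OF assms] by blast
  then have "(matrix_inv A *v axis l 1) $ k = det (\<chi> i j. if j = k then axis l 1 $ i else A $ i $ j) / det A" for k l
    by simp
  then show ?thesis
    by (simp add: vec_eq_iff matrix_vector_mult_basis column_def)
qed

lemma tendsto_matrix_inv:
  fixes f :: "'a \<Rightarrow> real^'n^'n"
  assumes lim: "(f \<longlongrightarrow> A) F" and "invertible A"
  shows "((\<lambda>t. matrix_inv (f t)) \<longlongrightarrow> matrix_inv A) F"
proof -
  have nz: "det A \<noteq> 0" using assms(2) invertible_det_nz by blast
  have "\<forall>\<^sub>F t in F. det (f t) \<noteq> 0"
    using tendsto_imp_eventually_ne[OF tendsto_det[OF lim] nz] .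
  then have ev: "\<forall>\<^sub>F t in F. (\<chi> k l. det (\<chi> i j. if j = k then axis l 1 $ i else f t $ i $ j) / det (f t)) = matrix_inv (f t)"
    by eventually_elim (simp add: matrix_inv_cramer)
  have lim_entry: "((\<lambda>t. if j = k then axis l 1 $ i else f t $ i $ j) \<longlongrightarrow>
      (if j = k then axis l 1 $ i else A $ i $ j)) F" for i j k l
    by (cases "j = k") (auto intro!: tendsto_intros lim)
  have "((\<lambda>t. \<chi> k l. det (\<chi> i j. if j = k then axis l 1 $ i else f t $ i $ j) / det (f t)) \<longlongrightarrow>
      (\<chi> k l. det (\<chi> i j. if j = k then axis l 1 $ i else A $ i $ j) / det A)) F"
    by (intro tendsto_intros tendsto_det lim nz lim_entry)
  then show ?thesis
    using ev by (simp add: matrix_inv_cramer[OF nz] tendsto_cong)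
qed

lemma has_vector_derivative_iff_slope:
  fixes f :: "real \<Rightarrow> 'a::real_normed_vector"
  shows "(f has_vector_derivative D) (at t within S) \<longleftrightarrow>
    ((\<lambda>y. (f y - f t) /\<^sub>R (y - t)) \<longlongrightarrow> D) (at t within S)"
proof -
  have eq: "norm (f y - f t - (y - t) *\<^sub>R D) / norm (y - t) = norm ((f y - f t) /\<^sub>R (y - t) - D)"
    if "y \<noteq> t" for y
  proof -
    have "(f y - f t) /\<^sub>R (y - t) - D = (f y - f t - (y - t) *\<^sub>R D) /\<^sub>R (y - t)"
      using that by (simp add: scaleR_diff_right)
    then show ?thesis by (simp add: divide_inverse mult.commute)
  qed
  have ev: "\<forall>\<^sub>F y in at t within S. norm (f y - f t - (y - t) *\<^sub>R D) / norm (y - t) = norm ((f y - f t) /\<^sub>R (y - t) - D)"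
    unfolding eventually_at_filter by (intro always_eventually allI impI eq)
  have "(f has_vector_derivative D) (at t within S) \<longleftrightarrow>
      ((\<lambda>y. norm (f y - f t - (y - t) *\<^sub>R D) / norm (y - t)) \<longlongrightarrow> 0) (at t within S)"
    unfolding has_vector_derivative_def has_derivative_iff_norm
    by (simp add: bounded_linear_scaleR_left)
  also have "\<dots> \<longleftrightarrow> ((\<lambda>y. norm ((f y - f t) /\<^sub>R (y - t) - D)) \<longlongrightarrow> 0) (at t within S)"
    by (rule tendsto_cong[OF ev])
  also have "\<dots> \<longleftrightarrow> ((\<lambda>y. (f y - f t) /\<^sub>R (y - t)) \<longlongrightarrow> D) (at t within S)"
    by (simp only: tendsto_norm_zero_iff LIM_zero_iff)
  finally show ?thesis .
qed

text \<open>The resolvent identity \<open>G\<inverse> - F\<inverse> = - G\<inverse> (G - F) F\<inverse>\<close> turns continuity of inversion into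
  differentiability.\<close>

lemma has_vector_derivative_matrix_inv:
  fixes F :: "real \<Rightarrow> real^'n^'n"
  assumes F: "(F has_vector_derivative F') (at t within S)" and inv: "invertible (F t)"
  shows "((\<lambda>s. matrix_inv (F s)) has_vector_derivative
    - (matrix_inv (F t) ** F' ** matrix_inv (F t))) (at t within S)"
proof -
  have cont: "(F \<longlongrightarrow> F t) (at t within S)"
    using has_vector_derivative_continuous[OF F] by (simp add: continuous_within)
  have "\<forall>\<^sub>F s in at t within S. det (F s) \<noteq> 0"
    using tendsto_imp_eventually_ne[OF tendsto_det[OF cont]] inv invertible_det_nz by blast
  then have ev: "\<forall>\<^sub>F s in at t within S. - (matrix_inv (F s) ** ((F s - F t) /\<^sub>R (s - t)) ** matrix_inv (F t))
      = (matrix_inv (F s) - matrix_inv (F t)) /\<^sub>R (s - t)"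
  proof eventually_elim
    case (elim s)
    then have "invertible (F s)" using invertible_det_nz by blast
    then have "matrix_inv (F s) ** F s ** matrix_inv (F t) = matrix_inv (F t)"
      by (simp add: matrix_inv_left)
    moreover have "matrix_inv (F s) ** F t ** matrix_inv (F t) = matrix_inv (F s)"
      by (simp add: matrix_mul_assoc[symmetric] matrix_inv_right inv)
    ultimately show ?case
      by (simp add: matrix_mult_simps scaleR_diff_right)
  qed
  have "((\<lambda>s. - (matrix_inv (F s) ** ((F s - F t) /\<^sub>R (s - t)) ** matrix_inv (F t))) \<longlongrightarrow>
      - (matrix_inv (F t) ** F' ** matrix_inv (F t))) (at t within S)"
    by (intro tendsto_minus bounded_bilinear.tendsto[OF bounded_bilinear_matrix_mult]
        tendsto_matrix_inv cont inv tendsto_const F[unfolded has_vector_derivative_iff_slope])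
  then show ?thesis
    unfolding has_vector_derivative_iff_slope using tendsto_cong[OF ev] by blast
qed

text \<open>In the Leibniz expansion of \<open>det (I + t B)\<close> a permutation other than the identity moves at
  least two points, so its term vanishes to second order; only the identity contributes.\<close>

lemma has_field_derivative_det_identity:
  fixes B :: "real^'n^'n"
  shows "((\<lambda>t. det (mat 1 + t *\<^sub>R B)) has_field_derivative trace B) (at 0)"
proof -
  let ?P = "{p. p permutes (UNIV :: 'n set)}"
  let ?f = "\<lambda>p i t. (mat 1 + t *\<^sub>R B) $ i $ p i :: real"
  have entry: "(?f p i has_field_derivative B $ i $ p i) (at 0)" for p i
    by (auto intro!: derivative_eq_intros)
  have summand: "((\<lambda>t. of_int (sign p) * (\<Prod>i\<in>UNIV. ?f p i t)) has_field_derivative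
      of_int (sign p) * (\<Sum>i\<in>UNIV. B $ i $ p i * (\<Prod>j\<in>UNIV - {i}. ?f p j 0))) (at 0)" for p
    by (intro DERIV_cmult has_field_derivative_prod entry)
  have val: "of_int (sign p) * (\<Sum>i\<in>UNIV. B $ i $ p i * (\<Prod>j\<in>UNIV - {i}. ?f p j 0)) =
      (if p = id then trace B else 0)" if "p \<in> ?P" for p
  proof (cases "p = id")
    case True
    then show ?thesis by (simp add: sign_id trace_def mat_def)
  next
    case False
    have zero: "(\<Prod>j\<in>UNIV - {i}. ?f p j 0) = 0" for i
    proof -
      have "\<exists>j. j \<noteq> i \<and> p j \<noteq> j"
      proof (rule ccontr)
        assume *: "\<not> ?thesis"
        have "inj p" using that by (simp add: permutes_inj)
        then have "p i = i" using * by (metis inj_eq)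
        with * have "p = id" by (metis eq_id_iff)
        with False show False by simp
      qed
      then obtain j where "j \<noteq> i" "p j \<noteq> j" by blast
      then show ?thesis
        by (intro prod_zero) (auto simp: mat_def intro!: bexI[of _ j])
    qed
    show ?thesis unfolding zero using False by simp
  qed
  have "((\<lambda>t. det (mat 1 + t *\<^sub>R B)) has_field_derivative
      (\<Sum>p\<in>?P. of_int (sign p) * (\<Sum>i\<in>UNIV. B $ i $ p i * (\<Prod>j\<in>UNIV - {i}. ?f p j 0)))) (at 0)"
    unfolding det_def by (rule DERIV_sum, rule summand)
  also have "(\<Sum>p\<in>?P. of_int (sign p) * (\<Sum>i\<in>UNIV. B $ i $ p i * (\<Prod>j\<in>UNIV - {i}. ?f p j 0))) =
      (\<Sum>p\<in>?P. if p = id then trace B else 0)"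
    by (rule sum.cong[OF refl val])
  also have "\<dots> = trace B"
    by (simp add: sum.delta' permutes_id[unfolded id_def[symmetric]] finite_permutations)
  finally show ?thesis .
qed

section \<open>The matrix exponential\<close>

abbreviation matrix_pow :: "real^'n^'n \<Rightarrow> nat \<Rightarrow> real^'n^'n" where
  "matrix_pow X k \<equiv> ((**) X ^^ k) (mat 1)"

lemma matrix_pow_scaleR: "matrix_pow (c *\<^sub>R X) k = c ^ k *\<^sub>R matrix_pow X k"
  by (induction k) (simp_all add: matrix_mult_simps mult.commute)

lemma matrix_pow_commute: "X ** matrix_pow X k = matrix_pow X k ** X"
proof (induction k)
  case (Suc k)
  then show ?case by simp (metis matrix_mul_assoc)
qed simp

lemma transpose_matrix_pow: "transpose (matrix_pow X k) = matrix_pow (transpose X) k"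
  by (induction k) (simp_all add: matrix_transpose_mul matrix_pow_commute)

lemma summable_matrix_exp:
  fixes X :: "real^'n^'n"
  shows "summable (\<lambda>k. (1 / fact k) *\<^sub>R matrix_pow X k)"
proof -
  obtain K where K: "K > 0" "\<And>(A :: real^'n^'n) (B :: real^'n^'n). norm (A ** B) \<le> norm A * norm B * K"
    using bounded_bilinear.pos_bounded[OF bounded_bilinear_matrix_mult] by blast
  let ?c = "norm X * K"
  have bound: "norm (matrix_pow X k) \<le> norm (mat 1 :: real^'n^'n) * ?c ^ k" for k
  proof (induction k)
    case (Suc k)
    have "norm (matrix_pow X (Suc k)) \<le> norm X * norm (matrix_pow X k) * K"
      using K(2)[of X "matrix_pow X k"] by simp
    also have "\<dots> = ?c * norm (matrix_pow X k)" by simp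
    also have "\<dots> \<le> ?c * (norm (mat 1 :: real^'n^'n) * ?c ^ k)"
      using Suc K(1) by (intro mult_left_mono) auto
    finally show ?case by (simp add: algebra_simps)
  qed simp
  have "summable (\<lambda>k. norm (mat 1 :: real^'n^'n) * (inverse (fact k) * ?c ^ k))"
    by (intro summable_mult summable_exp)
  then show ?thesis
    by (rule summable_comparison_test') (use bound in \<open>simp add: field_simps\<close>)
qed

lemma matrix_exp_sums: "(\<lambda>k. (t ^ k / fact k) *\<^sub>R matrix_pow X k) sums matrix_exp (t *\<^sub>R X)"
  using summable_sums[OF summable_matrix_exp[of "t *\<^sub>R X"]]
  by (simp add: matrix_exp_def matrix_pow_scaleR)

lemma matrix_exp_0 [simp]: "matrix_exp 0 = mat 1"
proof -
  have "(\<lambda>k. (0 ^ k / fact k) *\<^sub>R matrix_pow 0 k) sums (\<Sum>k\<in>{0::nat}. (0 ^ k / fact k) *\<^sub>R matrix_pow (0 :: real^'n^'n) k)"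
    by (rule sums_finite) auto
  then show ?thesis
    using matrix_exp_sums[of 0 "0 :: real^'n^'n"] sums_unique2 by fastforce
qed

lemma matrix_exp_commute:
  fixes X :: "real^'n^'n"
  shows "X ** matrix_exp (t *\<^sub>R X) = matrix_exp (t *\<^sub>R X) ** X"
proof -
  have "(\<lambda>k. X ** ((t ^ k / fact k) *\<^sub>R matrix_pow X k)) sums (X ** matrix_exp (t *\<^sub>R X))"
    by (rule bounded_linear.sums[OF bounded_bilinear.bounded_linear_right[OF bounded_bilinear_matrix_mult] matrix_exp_sums])
  moreover have "(\<lambda>k. (t ^ k / fact k) *\<^sub>R matrix_pow X k ** X) sums (matrix_exp (t *\<^sub>R X) ** X)"
    by (rule bounded_linear.sums[OF bounded_bilinear.bounded_linear_left[OF bounded_bilinear_matrix_mult] matrix_exp_sums])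
  ultimately show ?thesis
    by (auto simp: matrix_mult_simps matrix_pow_commute intro: sums_unique2)
qed

lemma transpose_matrix_exp:
  fixes X :: "real^'n^'n"
  shows "transpose (matrix_exp X) = matrix_exp (transpose X)"
proof -
  have "bounded_linear (transpose :: real^'n^'n \<Rightarrow> real^'n^'n)"
    unfolding linear_conv_bounded_linear[symmetric]
    by (rule linearI) (simp_all add: transpose_def vec_eq_iff)
  from bounded_linear.sums[OF this matrix_exp_sums[of 1 X]]
  have "(\<lambda>k. (1 ^ k / fact k) *\<^sub>R matrix_pow (transpose X) k) sums transpose (matrix_exp X)"
    by (simp add: transpose_scalar transpose_matrix_pow)
  then show ?thesis
    using matrix_exp_sums[of 1 "transpose X"] by (simp add: sums_unique2)
qed

text \<open>Each entry of \<open>exp (t X)\<close> is a scalar power series in \<open>t\<close>, which may be differentiated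
  term by term.\<close>

lemma has_vector_derivative_matrix_exp:
  fixes X :: "real^'n^'n"
  shows   "((\<lambda>t. matrix_exp (t *\<^sub>R X)) has_vector_derivative X ** matrix_exp (t *\<^sub>R X)) (at t within S)"
proof -
  have deriv: "((\<lambda>t. matrix_exp (t *\<^sub>R X) $ i $ j) has_field_derivative (X ** matrix_exp (t *\<^sub>R X)) $ i $ j) (at t)"
    for i j
  proof -
    let ?c = "\<lambda>k. matrix_pow X k $ i $ j / fact k"
    have lin: "bounded_linear (\<lambda>M :: real^'n^'n. M $ i $ j)"
      by (intro bounded_linear_compose[OF bounded_linear_vec_nth] bounded_linear_vec_nth)
    have exp: "(\<lambda>k. ?c k * t ^ k) sums matrix_exp (t *\<^sub>R X) $ i $ j" for t
      using bounded_linear.sums[OF lin matrix_exp_sums[of t X]] by (simp add: mult.commute)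
    have "(\<lambda>k. X ** ((t ^ k / fact k) *\<^sub>R matrix_pow X k)) sums (X ** matrix_exp (t *\<^sub>R X))"
      by (rule bounded_linear.sums[OF bounded_bilinear.bounded_linear_right[OF bounded_bilinear_matrix_mult] matrix_exp_sums])
    from bounded_linear.sums[OF lin this]
    have "(\<lambda>k. diffs ?c k * t ^ k) sums (X ** matrix_exp (t *\<^sub>R X)) $ i $ j"
      by (simp add: diffs_def matrix_mult_simps mult.commute del: of_nat_Suc)
    moreover have "((\<lambda>t. \<Sum>k. ?c k * t ^ k) has_field_derivative (\<Sum>k. diffs ?c k * t ^ k)) (at t)"
      by (rule termdiffs_strong_converges_everywhere) (rule sums_summable[OF exp])
    ultimately show ?thesis
      using exp by (simp add: sums_iff)
  qed
  have "((\<lambda>y. (matrix_exp (y *\<^sub>R X) - matrix_exp (t *\<^sub>R X)) /\<^sub>R (y - t)) \<longlongrightarrow> X ** matrix_exp (t *\<^sub>R X)) (at t)"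
    using deriv[unfolded has_real_derivative_iff_has_vector_derivative has_vector_derivative_iff_slope]
    by (intro vec_tendstoI) simp
  then have "((\<lambda>t. matrix_exp (t *\<^sub>R X)) has_vector_derivative X ** matrix_exp (t *\<^sub>R X)) (at t)"
    unfolding has_vector_derivative_iff_slope .
  then show ?thesis
    by (rule has_vector_derivative_at_within)
qed

lemma has_vector_derivative_matrix_exp_minus:
  fixes X :: "real^'n^'n"
  shows "((\<lambda>t. matrix_exp (- (t *\<^sub>R X))) has_vector_derivative - (X ** matrix_exp (- (t *\<^sub>R X)))) (at t within S)"
  using has_vector_derivative_matrix_exp[of "- X" t S]
  by (simp only: scaleR_minus_right matrix_mult_simps)

text \<open>\<open>F (t) exp (- t X)\<close> is constant along any solution of \<open>F' = F X\<close>.\<close>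

lemma linear_matrix_ode_first_integral:
  fixes F :: "real \<Rightarrow> real^'n^'n"
  assumes "convex S" "0 \<in> S" "t \<in> S"
    and F: "\<And>t. t \<in> S \<Longrightarrow> (F has_vector_derivative F t ** X) (at t within S)"
  shows "F t ** matrix_exp (- (t *\<^sub>R X)) = F 0"
proof -
  let ?H = "\<lambda>t. F t ** matrix_exp (- (t *\<^sub>R X))"
  have "(?H has_vector_derivative 0) (at t within S)" if "t \<in> S" for t
    using has_vector_derivative_matrix_mult[OF F[OF that] has_vector_derivative_matrix_exp_minus[of X t S]]
    by (simp only: matrix_mult_simps matrix_mul_assoc left_minus)
  from has_vector_derivative_zero_constant[OF assms(1) this]
  obtain c where c: "\<And>t. t \<in> S \<Longrightarrow> ?H t = c" by metis
  from c[OF \<open>0 \<in> S\<close>] have "c = F 0" by simp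
  with c[OF \<open>t \<in> S\<close>] show ?thesis by (simp only:)
qed

lemma matrix_exp_mult_minus:
  fixes X :: "real^'n^'n"
  shows "matrix_exp (t *\<^sub>R X) ** matrix_exp (- (t *\<^sub>R X)) = mat 1"
proof -
  have "((\<lambda>t. matrix_exp (t *\<^sub>R X)) has_vector_derivative matrix_exp (t *\<^sub>R X) ** X) (at t within UNIV)" for t
    using has_vector_derivative_matrix_exp[of X t UNIV] by (simp only: matrix_exp_commute)
  from linear_matrix_ode_first_integral[OF convex_UNIV _ _ this] show ?thesis by simp
qed

lemma linear_matrix_ode_unique:
  fixes F :: "real \<Rightarrow> real^'n^'n"
  assumes "convex S" "0 \<in> S" "t \<in> S"
    and F: "\<And>t. t \<in> S \<Longrightarrow> (F has_vector_derivative F t ** X) (at t within S)"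
  shows "F t = F 0 ** matrix_exp (t *\<^sub>R X)"
proof -
  have "matrix_exp (- (t *\<^sub>R X)) ** matrix_exp (t *\<^sub>R X) = mat 1"
    using matrix_exp_mult_minus[of "- t" X] by simp
  then have "F t = F t ** matrix_exp (- (t *\<^sub>R X)) ** matrix_exp (t *\<^sub>R X)"
    by (simp add: matrix_mul_assoc[symmetric])
  also have "\<dots> = F 0 ** matrix_exp (t *\<^sub>R X)"
    by (simp only: linear_matrix_ode_first_integral[OF assms])
  finally show ?thesis .
qed

text \<open>As a function of \<open>t\<close>, the left-hand side solves \<open>F' = F X\<close> with initial value \<open>exp (s X)\<close>.\<close>

lemma matrix_exp_add: "matrix_exp ((s + t) *\<^sub>R X) = matrix_exp (s *\<^sub>R X) ** matrix_exp (t *\<^sub>R X)"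
proof -
  have "((\<lambda>t. matrix_exp ((s + t) *\<^sub>R X)) has_vector_derivative matrix_exp ((s + t) *\<^sub>R X) ** X) (at t within UNIV)" for t
  proof -
    have "((+) s has_vector_derivative 1) (at t)"
      by (auto intro!: derivative_eq_intros)
    from vector_diff_chain_at[OF this, of "\<lambda>t. matrix_exp (t *\<^sub>R X)"]
      has_vector_derivative_matrix_exp[of X "s + t" UNIV]
    show ?thesis by (simp add: o_def matrix_exp_commute[symmetric])
  qed
  from linear_matrix_ode_unique[OF convex_UNIV _ _ this] show ?thesis by simp
qed

lemma invertible_matrix_exp: "invertible (matrix_exp X)"
  using matrix_exp_mult_minus[of 1 X] matrix_exp_mult_minus[of "-1" X] unfolding invertible_def by auto

text \<open>A symmetric matrix has a symmetric exponential, which is the square of the exponential of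
  half the matrix.\<close>

lemma matrix_exp_symmetric_square:
  assumes "transpose X = X"
  shows "matrix_exp ((t / 2) *\<^sub>R X) ** transpose (matrix_exp ((t / 2) *\<^sub>R X)) = matrix_exp (t *\<^sub>R X)"
  using matrix_exp_add[of "t / 2" "t / 2" X] assms
  by (simp add: transpose_matrix_exp transpose_scalar)

section \<open>Linear change of variables for the Lebesgue measure\<close>

lemma Basis_vec_axis: "(Basis :: (real^'n) set) = range (\<lambda>i. axis i 1)"
  by (auto simp: Basis_vec_def)

lemma inj_axis_1: "inj (\<lambda>i::'n::finite. axis i (1::real))"
  by (auto simp: inj_def axis_eq_axis)

lemma prod_Basis_vec: "(\<Prod>b\<in>Basis. (x :: real^'n) \<bullet> b) = (\<Prod>i\<in>UNIV. x $ i)"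
  unfolding Basis_vec_axis prod.reindex[OF inj_axis_1] by (simp add: inner_axis)

lemma emeasure_lborel_box_vec:
  fixes l u :: "real^'n"
  assumes "\<And>i. l $ i \<le> u $ i"
  shows "emeasure lborel (box l u) = (\<Prod>i\<in>UNIV. u $ i - l $ i)"
proof -
  have "l \<bullet> b \<le> u \<bullet> b" if "b \<in> Basis" for b
    using that assms by (auto simp: Basis_vec_def inner_axis)
  then show ?thesis by (simp add: emeasure_lborel_box prod_Basis_vec)
qed

lemma lborel_eqI_vec:
  fixes M :: "(real^'n) measure"
  assumes "\<And>l u. (\<And>i. l $ i \<le> u $ i) \<Longrightarrow> emeasure M (box l u) = (\<Prod>i\<in>UNIV. u $ i - l $ i)"
    and "sets M = sets borel"
  shows "lborel = M"
proof (rule lborel_eqI)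
  fix l u :: "real^'n" assume le: "\<And>b. b \<in> Basis \<Longrightarrow> l \<bullet> b \<le> u \<bullet> b"
  have "l $ i \<le> u $ i" for i
    using le[of "axis i 1"] by (simp add: inner_axis)
  then show "emeasure M (box l u) = (\<Prod>b\<in>Basis. (u - l) \<bullet> b)"
    by (simp add: assms(1) prod_Basis_vec)
qed (rule assms(2))

lemma measurable_vec_lambda [measurable]:
  "(\<lambda>f. \<chi> i. f i) \<in> (\<Pi>\<^sub>M i\<in>(UNIV :: 'n::finite set). lborel :: real measure) \<rightarrow>\<^sub>M borel"
proof (subst borel_measurable_euclidean_space, intro ballI)
  fix b :: "real^'n" assume "b \<in> Basis"
  then obtain i where "b = axis i 1" by (auto simp: Basis_vec_def)
  then show "(\<lambda>f. (\<chi> i. f i) \<bullet> b) \<in> borel_measurable (\<Pi>\<^sub>M i\<in>(UNIV :: 'n set). lborel :: real measure)"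
    by (simp add: inner_axis)
qed

lemma measurable_matrix_vector_mult [measurable]: "(*v) A \<in> borel \<rightarrow>\<^sub>M borel" for A :: "real^'n^'m"
  by (intro borel_measurable_continuous_onI linear_continuous_on matrix_vector_mul_bounded_linear)

text \<open>Describing the Lebesgue measure as a product indexed by the coordinates themselves, rather than
  by basis vectors, gives direct access to Fubini and to integrals of products.\<close>

lemma lborel_vec:
  "(lborel :: (real^'n) measure) = distr (\<Pi>\<^sub>M i\<in>UNIV. lborel) borel (\<lambda>f. \<chi> i. f i)"
proof (rule lborel_eqI_vec)
  interpret product_sigma_finite "\<lambda>i::'n. lborel :: real measure" by standard
  fix l u :: "real^'n" assume le: "\<And>i. l $ i \<le> u $ i"
  have "(\<lambda>f. \<chi> i. f i) -` box l u \<inter> space (\<Pi>\<^sub>M i\<in>UNIV. lborel) = (\<Pi>\<^sub>E i\<in>UNIV. {l $ i <..< u $ i})"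
    by (auto simp: space_PiM mem_box_cart PiE_def Pi_def)
  then show "emeasure (distr (\<Pi>\<^sub>M i\<in>UNIV. lborel) borel (\<lambda>f. \<chi> i. f i)) (box l u) = (\<Prod>i\<in>UNIV. u $ i - l $ i)"
    using le by (simp add: emeasure_distr emeasure_PiM prod_ennreal)
qed simp

text \<open>A shear translates each line parallel to one coordinate axis, so by Fubini it preserves
  the Lebesgue measure.\<close>

lemma lborel_distr_shear:
  fixes m n :: "'n::finite"
  assumes "m \<noteq> n"
  shows "distr lborel borel ((*v) (\<chi> i j. of_bool (i = m \<and> j = n \<or> i = j))) = (lborel :: (real^'n) measure)"
proof (rule measure_eqI)
  let ?A = "(\<chi> i j. of_bool (i = m \<and> j = n \<or> i = j)) :: real^'n^'n"
  interpret product_sigma_finite "\<lambda>i::'n. lborel :: real measure" by standard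
  have shear: "?A *v (\<chi> i. (f(m := y)) i) = (\<chi> i. (f(m := f n + y)) i)" for f :: "'n \<Rightarrow> real" and y
  proof -
    have *: "of_bool (i = m \<and> j = n \<or> i = j) = (of_bool (j = i) + (if i = m then of_bool (j = n) else 0) :: real)" for i j
      using assms by auto
    have "(\<Sum>j\<in>UNIV. of_bool (i = m \<and> j = n \<or> i = j) * x j) = x i + (if i = m then x n else 0)"
      for i and x :: "'n \<Rightarrow> real"
      unfolding * by (simp add: distrib_right sum.distrib of_bool_def if_distrib[of "\<lambda>c. c * _"] cong: if_cong)
    then show ?thesis
      using assms by (simp add: matrix_vector_mult_def vec_eq_iff)
  qed
  fix B :: "(real^'n) set" assume "B \<in> sets (distr lborel borel ((*v) ?A))"
  then have [measurable]: "B \<in> sets borel" by simp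
  have fubini: "(\<integral>\<^sup>+x. g x \<partial>lborel) =
      (\<integral>\<^sup>+f. \<integral>\<^sup>+y. g (\<chi> i. (f(m := y)) i) \<partial>lborel \<partial>(\<Pi>\<^sub>M i\<in>UNIV - {m}. lborel))"
    if [measurable]: "g \<in> borel_measurable borel" for g :: "real^'n \<Rightarrow> ennreal"
  proof -
    have ins: "insert m (UNIV - {m}) = UNIV" by auto
    have "(\<integral>\<^sup>+x. g x \<partial>lborel) = (\<integral>\<^sup>+f. g (\<chi> i. f i) \<partial>(\<Pi>\<^sub>M i\<in>insert m (UNIV - {m}). lborel))"
      unfolding ins by (subst lborel_vec) (simp add: nn_integral_distr)
    also have "\<dots> = (\<integral>\<^sup>+f. \<integral>\<^sup>+y. g (\<chi> i. (f(m := y)) i) \<partial>lborel \<partial>(\<Pi>\<^sub>M i\<in>UNIV - {m}. lborel))"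
      by (rule product_nn_integral_insert) (auto simp: insert_absorb)
    finally show ?thesis .
  qed
  have "emeasure (distr lborel borel ((*v) ?A)) B = (\<integral>\<^sup>+x. indicator B (?A *v x) \<partial>lborel)"
    by (simp add: nn_integral_distr flip: nn_integral_indicator)
  also have "\<dots> = (\<integral>\<^sup>+f. \<integral>\<^sup>+y. indicator B (\<chi> i. (f(m := f n + 1 * y)) i) \<partial>lborel \<partial>(\<Pi>\<^sub>M i\<in>UNIV - {m}. lborel))"
    by (subst fubini) (simp_all only: shear mult_1, measurable)
  also have "\<dots> = (\<integral>\<^sup>+f. \<integral>\<^sup>+y. indicator B (\<chi> i. (f(m := y)) i) \<partial>lborel \<partial>(\<Pi>\<^sub>M i\<in>UNIV - {m}. lborel))"
  proof (rule nn_integral_cong)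
    fix f :: "'n \<Rightarrow> real"
    have "continuous_on UNIV (\<lambda>y. (f(m := y)) i)" for i
      by (cases "i = m") simp_all
    then have "(\<lambda>y. \<chi> i. (f(m := y)) i) \<in> borel \<rightarrow>\<^sub>M borel"
      by (intro borel_measurable_continuous_onI continuous_on_vec_lambda)
    then have "(\<lambda>y. indicator B (\<chi> i. (f(m := y)) i) :: ennreal) \<in> borel_measurable borel"
      by (rule measurable_compose) simp
    from nn_integral_real_affine[OF this, of 1 "f n"]
    show "(\<integral>\<^sup>+y. indicator B (\<chi> i. (f(m := f n + 1 * y)) i) \<partial>lborel) = (\<integral>\<^sup>+y. indicator B (\<chi> i. (f(m := y)) i) \<partial>lborel)"
      by simp
  qed
  also have "\<dots> = emeasure lborel B"
    by (subst fubini[symmetric]) simp_all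
  finally show "emeasure (distr lborel borel ((*v) ?A)) B = emeasure lborel B" .
qed simp

lemma lborel_distr_swap:
  fixes m n :: "'n::finite"
  shows "distr lborel borel ((*v) (\<chi> i j. mat 1 $ i $ Transposition.transpose m n j)) = (lborel :: (real^'n) measure)"
proof (rule lborel_eqI_vec[symmetric])
  let ?A = "(\<chi> i j. mat 1 $ i $ Transposition.transpose m n j) :: real^'n^'n"
  let ?s = "Transposition.transpose m n"
  have perm: "(?A *v x) $ i = x $ ?s i" for x i
  proof -
    have "i = ?s j \<longleftrightarrow> j = ?s i" for j by (metis transpose_involutory)
    then have "(?A *v x) $ i = (\<Sum>j\<in>UNIV. (if j = ?s i then 1 else 0) * x $ j)"
      by (simp add: matrix_vector_mult_def mat_def)
    then show ?thesis by (simp add: if_distrib[of "\<lambda>c. c * _"] cong: if_cong)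
  qed
  have reindex: "(\<Prod>i\<in>UNIV. g (?s i)) = (\<Prod>i\<in>UNIV. g i)" for g :: "'n \<Rightarrow> real"
    by (rule prod.reindex_bij_betw) simp
  have all: "(\<forall>i. P (?s i)) \<longleftrightarrow> (\<forall>i. P i)" for P
    by (metis transpose_involutory)
  fix l u :: "real^'n" assume le: "\<And>i. l $ i \<le> u $ i"
  have "(*v) ?A -` box l u = box (\<chi> i. l $ ?s i) (\<chi> i. u $ ?s i)"
  proof (rule set_eqI)
    fix x :: "real^'n"
    show "x \<in> (*v) ?A -` box l u \<longleftrightarrow> x \<in> box (\<chi> i. l $ ?s i) (\<chi> i. u $ ?s i)"
      using all[of "\<lambda>i. l $ i < x $ ?s i \<and> x $ ?s i < u $ i"] by (simp add: mem_box_cart perm)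
  qed
  then show "emeasure (distr lborel borel ((*v) ?A)) (box l u) = (\<Prod>i\<in>UNIV. u $ i - l $ i)"
    using le reindex[of "\<lambda>i. u $ i - l $ i"]
    by (simp add: emeasure_distr emeasure_lborel_box_vec)
qed simp

lemma lborel_distr_diagonal:
  fixes A :: "real^'n^'n"
  assumes diag: "\<And>i j. i \<noteq> j \<Longrightarrow> A $ i $ j = 0" and "det A \<noteq> 0"
  shows "lborel = density (distr lborel borel ((*v) A)) (\<lambda>_. \<bar>det A\<bar>)"
proof -
  let ?c = "\<lambda>b. b \<bullet> (A *v b)"
  have det: "det A = (\<Prod>i\<in>UNIV. A $ i $ i)" by (rule det_diagonal) (rule diag)
  have c_axis: "?c (axis i 1) = A $ i $ i" for i
    by (simp add: inner_axis' matrix_vector_mult_basis column_def)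
  have prod: "(\<Prod>b\<in>Basis. \<bar>?c b\<bar>) = \<bar>det A\<bar>"
    unfolding Basis_vec_axis prod.reindex[OF inj_axis_1] by (simp add: c_axis det abs_prod)
  have nz: "?c b \<noteq> 0" if "b \<in> Basis" for b
    using that assms(2) by (auto simp: Basis_vec_axis c_axis det)
  have "(\<Sum>j\<in>Basis. (?c j * (x \<bullet> j)) *\<^sub>R j) = A *v x" for x
  proof -
    have "(A *v x) $ i = A $ i $ i * x $ i" for i
      by (simp add: matrix_vector_mult_def comm_monoid_add_class.sum.remove[where x=i] diag)
    then show ?thesis
      unfolding Basis_vec_axis sum.reindex[OF inj_axis_1]
      by (simp add: c_axis inner_axis vec_eq_iff) (simp add: axis_def if_distrib cong: if_cong)
  qed
  then show ?thesis
    using lborel_affine_euclidean[where c="?c" and t=0, OF nz] by (simp add: prod)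
qed

text \<open>The formula is inherited by products of matrices, so it is enough to treat elementary matrices:
  a diagonal matrix scales the coordinate axes, and swaps and shears preserve the measure and have
  determinant \<open>1\<close> in absolute value.\<close>

lemma lborel_linear_image:
  fixes A :: "real^'n^'n"
  assumes "det A \<noteq> 0"
  shows "lborel = density (distr lborel borel ((*v) A)) (\<lambda>_. \<bar>det A\<bar>)"
  using assms
proof (induction A rule: induct_matrix_elementary_alt)
  case (1 A B)
  from 1(3) have nz: "det A \<noteq> 0" "det B \<noteq> 0" by (auto simp: det_mul)
  have "lborel = density (distr (density (distr lborel borel ((*v) B)) (\<lambda>_. \<bar>det B\<bar>)) borel ((*v) A)) (\<lambda>_. \<bar>det A\<bar>)"
    using 1(1)[OF nz(1)] 1(2)[OF nz(2)] by simp
  also have "\<dots> = density (density (distr (distr lborel borel ((*v) B)) borel ((*v) A)) (\<lambda>_. \<bar>det B\<bar>)) (\<lambda>_. \<bar>det A\<bar>)"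
    by (subst density_distr) simp_all
  also have "\<dots> = density (distr lborel borel ((*v) (A ** B))) (\<lambda>_. \<bar>det (A ** B)\<bar>)"
    by (simp add: density_density_eq distr_distr det_mul abs_mult ennreal_mult mult.commute
        matrix_vector_mult_matrix_matrix_mult_compose)
  finally show ?case .
next
  case (2 A i)
  then show ?case using det_zero_row by blast
next
  case (3 A)
  then show ?case using lborel_distr_diagonal by blast
next
  case (4 m n)
  have "\<bar>det (\<chi> i j. mat 1 $ i $ Transposition.transpose m n j :: real^'n^'n)\<bar> = 1"
    by (simp add: det_permute_columns permutes_swap_id sign_swap_id abs_mult)
  then show ?case by (simp add: lborel_distr_swap density_1)
next
  case (5 m n)
  have "det (\<chi> i j. of_bool (i = m \<and> j = n \<or> i = j) :: real^'n^'n) = 1"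
  proof -
    have "(\<chi> i j. of_bool (i = m \<and> j = n \<or> i = j) :: real^'n^'n) =
        (\<chi> k. if k = m then row m (mat 1) + 1 *s row n (mat 1) else row k (mat 1))"
      using 5 by (auto simp: vec_eq_iff row_def mat_def)
    then show ?thesis by (simp only: det_row_operation[OF 5(1)] det_I)
  qed
  then show ?case by (simp only: lborel_distr_shear[OF 5(1)] density_1 abs_one ennreal_1)
qed

section \<open>Moments of the standard Gaussian\<close>

definition std_gaussian_density :: "real^'n \<Rightarrow> real" where
  "std_gaussian_density z = (\<Prod>i\<in>UNIV. std_normal_density (z $ i))"

definition std_moment :: "nat \<Rightarrow> real" where
  "std_moment k = (\<integral>x. std_normal_density x * x ^ k \<partial>lborel)"

lemma std_moment_values:
  "std_moment 0 = 1" "std_moment (Suc 0) = 0" "std_moment 2 = 1" "std_moment 3 = 0" "std_moment 4 = 3"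
  using integral_std_normal_moment_even[of 0] integral_std_normal_moment_odd[of 0]
    integral_std_normal_moment_even[of 1] integral_std_normal_moment_odd[of 1]
    integral_std_normal_moment_even[of 2]
  by (simp_all add: std_moment_def fact_numeral numeral_3_eq_3)

lemmas std_moment_simps = std_moment_values[unfolded numeral_nat]

text \<open>The coordinates are independent, so the expectation of a monomial is a product of
  one-dimensional moments.\<close>

lemma has_bochner_integral_gaussian_monomial:
  fixes c :: "'n::finite \<Rightarrow> nat"
  shows "has_bochner_integral lborel (\<lambda>z::real^'n. std_gaussian_density z * (\<Prod>i\<in>UNIV. z $ i ^ c i))
    (\<Prod>i\<in>UNIV. std_moment (c i))"
proof -
  interpret product_sigma_finite "\<lambda>i::'n. lborel :: real measure" by standard
  let ?f = "\<lambda>i x. std_normal_density x * x ^ c i"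
  have eq: "std_gaussian_density z * (\<Prod>i\<in>UNIV. z $ i ^ c i) = (\<Prod>i\<in>UNIV. ?f i (z $ i))" for z :: "real^'n"
    by (simp add: std_gaussian_density_def prod.distrib)
  have int: "integrable lborel (?f i)" for i
    by (rule integrable_std_normal_moment)
  have meas: "(\<lambda>z::real^'n. \<Prod>i\<in>UNIV. ?f i (z $ i)) \<in> borel_measurable borel"
    by measurable
  have "integrable (\<Pi>\<^sub>M i\<in>UNIV. lborel) (\<lambda>x. \<Prod>i\<in>UNIV. ?f i (x i))"
    by (rule product_integrable_prod) (simp_all add: int)
  moreover have "(\<integral>x. (\<Prod>i\<in>UNIV. ?f i (x i)) \<partial>(\<Pi>\<^sub>M i\<in>UNIV. lborel)) = (\<Prod>i\<in>UNIV. std_moment (c i))"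
    unfolding std_moment_def by (rule product_integral_prod) (simp_all add: int)
  ultimately show ?thesis
    unfolding eq has_bochner_integral_iff
    by (subst (1 2) lborel_vec) (simp add: integrable_distr_eq integral_distr meas)
qed

lemma prod_power_of_bool: "(\<Prod>m\<in>UNIV. z $ m ^ of_bool (m = i)) = z $ i" for z :: "real^'n"
proof -
  have "(\<Prod>m\<in>UNIV. z $ m ^ of_bool (m = i)) = (\<Prod>m\<in>UNIV. if m = i then z $ m else 1)"
    by (intro prod.cong) auto
  then show ?thesis by simp
qed

abbreviation delta :: "'n \<Rightarrow> 'n \<Rightarrow> real" where "delta i j \<equiv> of_bool (i = j)"

lemma sum_delta: "(\<Sum>l\<in>UNIV. f l * delta j l) = f j" for f :: "'n::finite \<Rightarrow> real"
  by simp

lemma gaussian_moment_1: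
  "has_bochner_integral lborel (\<lambda>z::real^'n. std_gaussian_density z * z $ i) 0"
proof -
  have "(\<Prod>m\<in>UNIV. std_moment (of_bool (m = i))) = 0"
    by (auto simp: std_moment_values intro!: bexI[of _ i])
  then show ?thesis
    using has_bochner_integral_gaussian_monomial[of "\<lambda>m. of_bool (m = i)"]
    by (simp only: prod_power_of_bool)
qed

lemma gaussian_moment_0: "has_bochner_integral lborel (\<lambda>z::real^'n. std_gaussian_density z) 1"
  using has_bochner_integral_gaussian_monomial[of "\<lambda>m::'n. 0"] by (simp add: std_moment_values)

text \<open>Coordinates in which the monomial has degree zero contribute the factor \<open>1\<close>.  The remaining
  product runs over the listed indices and is evaluated by distinguishing which of them coincide;
  an index of odd multiplicity makes it vanish.  For degree four this is the formula of
  Isserlis.\<close>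

lemma gaussian_moment_2:
  "has_bochner_integral lborel (\<lambda>z::real^'n. std_gaussian_density z * (z $ i * z $ j)) (delta i j)"
proof -
  let ?c = "\<lambda>m. of_bool (m = i) + of_bool (m = j) :: nat"
  have "(\<Prod>m\<in>UNIV. std_moment (?c m)) = (\<Prod>m\<in>{i, j}. std_moment (?c m))"
    by (rule prod.mono_neutral_right) (auto simp: std_moment_simps)
  also have "\<dots> = delta i j"
    by (cases "i = j") (simp_all add: std_moment_simps insert_commute)
  finally show ?thesis
    using has_bochner_integral_gaussian_monomial[of ?c]
    by (simp only: power_add prod.distrib prod_power_of_bool)
qed

lemma gaussian_moment_3:
  "has_bochner_integral lborel (\<lambda>z::real^'n. std_gaussian_density z * (z $ i * z $ j * z $ k)) 0"
proof -
  let ?c = "\<lambda>m. of_bool (m = i) + of_bool (m = j) + of_bool (m = k) :: nat"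
  have "(\<Prod>m\<in>UNIV. std_moment (?c m)) = (\<Prod>m\<in>{i, j, k}. std_moment (?c m))"
    by (rule prod.mono_neutral_right) (auto simp: std_moment_simps)
  also have "\<dots> = 0"
    by (cases "i = j"; cases "i = k"; cases "j = k") (simp_all add: std_moment_simps insert_commute)
  finally show ?thesis
    using has_bochner_integral_gaussian_monomial[of ?c]
    by (simp only: power_add prod.distrib prod_power_of_bool)
qed

lemma gaussian_moment_4:
  "has_bochner_integral lborel (\<lambda>z::real^'n. std_gaussian_density z * (z $ i * z $ j * z $ k * z $ l))
    (delta i j * delta k l + delta i k * delta j l + delta i l * delta j k)"
proof -
  let ?c = "\<lambda>m. of_bool (m = i) + of_bool (m = j) + of_bool (m = k) + of_bool (m = l) :: nat"
  have "(\<Prod>m\<in>UNIV. std_moment (?c m)) = (\<Prod>m\<in>{i, j, k, l}. std_moment (?c m))"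
    by (rule prod.mono_neutral_right) (auto simp: std_moment_simps)
  also have "\<dots> = delta i j * delta k l + delta i k * delta j l + delta i l * delta j k"
    by (cases "i = j"; cases "i = k"; cases "j = k"; cases "i = l"; cases "j = l"; cases "k = l")
      (simp_all add: std_moment_simps insert_commute)
  finally show ?thesis
    using has_bochner_integral_gaussian_monomial[of ?c]
    by (simp only: power_add prod.distrib prod_power_of_bool)
qed

text \<open>The centred quadratic form \<open>z\<^sup>T B z - tr B\<close> is a combination of the second Hermite polynomials
  \<open>z\<^sub>i z\<^sub>j - \<delta>\<^sub>i\<^sub>j\<close>, which are orthogonal to the linear functions.\<close>

definition hermite2 :: "'n \<Rightarrow> 'n \<Rightarrow> real^'n \<Rightarrow> real" where
  "hermite2 i j z = z $ i * z $ j - delta i j"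

lemma quadratic_form_hermite2:
  fixes B :: "real^'n^'n"
  shows "z \<bullet> (B *v z) - trace B = (\<Sum>i\<in>UNIV. \<Sum>j\<in>UNIV. B $ i $ j * hermite2 i j z)"
proof -
  have "(\<Sum>j\<in>UNIV. B $ i $ j * hermite2 i j z) = z $ i * (B *v z) $ i - B $ i $ i" for i
    by (simp add: hermite2_def right_diff_distrib sum_subtractf matrix_vector_mult_def sum_distrib_left mult_ac)
  then show ?thesis
    by (simp add: inner_vec_def trace_def sum_subtractf)
qed

lemma gaussian_moment_hermite2_linear:
  "has_bochner_integral lborel (\<lambda>z::real^'n. std_gaussian_density z * (z $ i * hermite2 j k z)) 0"
proof -
  have "has_bochner_integral lborel (\<lambda>z::real^'n. std_gaussian_density z * (z $ i * z $ j * z $ k)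
      - std_gaussian_density z * z $ i * delta j k) (0 - 0 * delta j k)"
    by (intro has_bochner_integral_diff has_bochner_integral_mult_left gaussian_moment_3 gaussian_moment_1)
  then show ?thesis
    by (simp add: hermite2_def algebra_simps)
qed

lemma gaussian_moment_hermite2:
  "has_bochner_integral lborel (\<lambda>z::real^'n. std_gaussian_density z * (hermite2 i j z * hermite2 k l z))
    (delta i k * delta j l + delta i l * delta j k)"
proof -
  have "has_bochner_integral lborel (\<lambda>z::real^'n. std_gaussian_density z * (z $ i * z $ j * z $ k * z $ l)
      - std_gaussian_density z * (z $ i * z $ j) * delta k l
      - std_gaussian_density z * (z $ k * z $ l) * delta i j
      + std_gaussian_density z * (delta i j * delta k l))
    (delta i j * delta k l + delta i k * delta j l + delta i l * delta j k
      - delta i j * delta k l - delta k l * delta i j + 1 * (delta i j * delta k l))"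
    by (intro has_bochner_integral_add has_bochner_integral_diff has_bochner_integral_mult_left
        gaussian_moment_4 gaussian_moment_2 gaussian_moment_0)
  then show ?thesis
    by (simp add: hermite2_def algebra_simps)
qed

lemma gaussian_linear_linear:
  fixes a b :: "real^'n"
  shows "has_bochner_integral lborel (\<lambda>z. std_gaussian_density z * ((a \<bullet> z) * (b \<bullet> z))) (a \<bullet> b)"
proof -
  have "has_bochner_integral lborel
      (\<lambda>z. \<Sum>i\<in>UNIV. \<Sum>j\<in>UNIV. a $ i * b $ j * (std_gaussian_density z * (z $ i * z $ j)))
      (\<Sum>i\<in>UNIV. \<Sum>j\<in>UNIV. a $ i * b $ j * delta i j)"
    by (intro has_bochner_integral_sum has_bochner_integral_mult_right gaussian_moment_2)
  moreover have "(\<Sum>i\<in>UNIV. \<Sum>j\<in>UNIV. a $ i * b $ j * delta i j) = a \<bullet> b"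
    by (simp add: inner_vec_def of_bool_def if_distrib cong: if_cong)
  moreover have "std_gaussian_density z * ((a \<bullet> z) * (b \<bullet> z)) =
      (\<Sum>i\<in>UNIV. \<Sum>j\<in>UNIV. a $ i * b $ j * (std_gaussian_density z * (z $ i * z $ j)))" for z
    unfolding inner_vec_def sum_product unfolding sum_distrib_left by (simp add: mult_ac)
  ultimately show ?thesis by simp
qed

lemma gaussian_linear_quadratic:
  fixes a :: "real^'n" and B :: "real^'n^'n"
  shows "has_bochner_integral lborel
    (\<lambda>z. std_gaussian_density z * ((a \<bullet> z) * (z \<bullet> (B *v z) - trace B))) 0"
proof -
  have "has_bochner_integral lborel
      (\<lambda>z. \<Sum>i\<in>UNIV. \<Sum>j\<in>UNIV. \<Sum>k\<in>UNIV. a $ i * B $ j $ k * (std_gaussian_density z * (z $ i * hermite2 j k z)))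
      (\<Sum>i\<in>UNIV. \<Sum>j\<in>UNIV. \<Sum>k\<in>UNIV. a $ i * B $ j $ k * 0)"
    by (intro has_bochner_integral_sum has_bochner_integral_mult_right gaussian_moment_hermite2_linear)
  moreover have "std_gaussian_density z * ((a \<bullet> z) * (z \<bullet> (B *v z) - trace B)) =
      (\<Sum>i\<in>UNIV. \<Sum>j\<in>UNIV. \<Sum>k\<in>UNIV. a $ i * B $ j $ k * (std_gaussian_density z * (z $ i * hermite2 j k z)))" for z
    unfolding quadratic_form_hermite2 unfolding inner_vec_def sum_product unfolding sum_distrib_left
    by (simp add: mult_ac)
  ultimately show ?thesis by simp
qed

text \<open>The two pairings of indices in \<open>gaussian_moment_hermite2\<close> give \<open>\<Sum> B\<^sub>i\<^sub>j C\<^sub>i\<^sub>j\<close> and \<open>\<Sum> B\<^sub>i\<^sub>j C\<^sub>j\<^sub>i\<close>, which agree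
  because \<open>C\<close> is symmetric.\<close>

lemma gaussian_quadratic_quadratic:
  fixes B C :: "real^'n^'n"
  assumes "transpose C = C"
  shows "has_bochner_integral lborel
    (\<lambda>z. std_gaussian_density z * ((z \<bullet> (B *v z) - trace B) * (z \<bullet> (C *v z) - trace C))) (2 * trace (B ** C))"
proof -
  have C: "C $ i $ j = C $ j $ i" for i j
    using assms by (metis transpose_def vec_lambda_beta)
  have "has_bochner_integral lborel
      (\<lambda>z. \<Sum>i\<in>UNIV. \<Sum>k\<in>UNIV. \<Sum>j\<in>UNIV. \<Sum>l\<in>UNIV.
        B $ i $ j * C $ k $ l * (std_gaussian_density z * (hermite2 i j z * hermite2 k l z)))
      (\<Sum>i\<in>UNIV. \<Sum>k\<in>UNIV. \<Sum>j\<in>UNIV. \<Sum>l\<in>UNIV.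
        B $ i $ j * C $ k $ l * (delta i k * delta j l + delta i l * delta j k))"
    by (intro has_bochner_integral_sum has_bochner_integral_mult_right gaussian_moment_hermite2)
  moreover have "(\<Sum>i\<in>UNIV. \<Sum>k\<in>UNIV. \<Sum>j\<in>UNIV. \<Sum>l\<in>UNIV.
        B $ i $ j * C $ k $ l * (delta i k * delta j l + delta i l * delta j k)) = 2 * trace (B ** C)"
  proof -
    have l: "(\<Sum>l\<in>UNIV. B $ i $ j * C $ k $ l * (delta i k * delta j l + delta i l * delta j k)) =
        B $ i $ j * C $ k $ j * delta i k + B $ i $ j * C $ k $ i * delta j k" for i j k
    proof -
      have "(\<Sum>l\<in>UNIV. B $ i $ j * C $ k $ l * (delta i k * delta j l + delta i l * delta j k)) =
        (\<Sum>l\<in>UNIV. (B $ i $ j * C $ k $ l * delta i k) * delta j l + (B $ i $ j * C $ k $ l * delta j k) * delta i l)"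
        by (simp only: distrib_left mult_ac)
      then show ?thesis by (simp only: sum.distrib sum_delta)
    qed
    have k: "(\<Sum>k\<in>UNIV. \<Sum>j\<in>UNIV. B $ i $ j * C $ k $ j * delta i k + B $ i $ j * C $ k $ i * delta j k) =
        (\<Sum>j\<in>UNIV. B $ i $ j * C $ i $ j + B $ i $ j * C $ j $ i)" for i
      by (subst sum.swap) (simp only: sum.distrib sum_delta)
    have j: "B $ i $ j * C $ i $ j + B $ i $ j * C $ j $ i = 2 * (B $ i $ j * C $ j $ i)" for i j
      using C[of i j] by simp
    show ?thesis
      unfolding l k j by (simp add: trace_def matrix_matrix_mult_def sum_distrib_left)
  qed
  moreover have "std_gaussian_density z * ((z \<bullet> (B *v z) - trace B) * (z \<bullet> (C *v z) - trace C)) =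
      (\<Sum>i\<in>UNIV. \<Sum>k\<in>UNIV. \<Sum>j\<in>UNIV. \<Sum>l\<in>UNIV.
        B $ i $ j * C $ k $ l * (std_gaussian_density z * (hermite2 i j z * hermite2 k l z)))" for z
    unfolding quadratic_form_hermite2 sum_product unfolding sum_distrib_left by (simp only: mult_ac)
  ultimately show ?thesis by simp
qed

text \<open>The expectation of the product of two whitened scores: the mixed terms vanish, so the mean and
  the covariance directions are orthogonal.\<close>

lemma gaussian_score_covariance:
  fixes a b :: "real^'n" and B C :: "real^'n^'n"
  assumes "transpose C = C"
  shows "has_bochner_integral lborel
    (\<lambda>z. std_gaussian_density z *
      ((a \<bullet> z + (z \<bullet> (B *v z) - trace B) / 2) * (b \<bullet> z + (z \<bullet> (C *v z) - trace C) / 2)))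
    (a \<bullet> b + trace (B ** C) / 2)"
proof -
  have "has_bochner_integral lborel
    (\<lambda>z. std_gaussian_density z * ((a \<bullet> z) * (b \<bullet> z))
       + 1 / 2 * (std_gaussian_density z * ((a \<bullet> z) * (z \<bullet> (C *v z) - trace C)))
       + 1 / 2 * (std_gaussian_density z * ((b \<bullet> z) * (z \<bullet> (B *v z) - trace B)))
       + 1 / 4 * (std_gaussian_density z * ((z \<bullet> (B *v z) - trace B) * (z \<bullet> (C *v z) - trace C))))
    (a \<bullet> b + 1 / 2 * 0 + 1 / 2 * 0 + 1 / 4 * (2 * trace (B ** C)))"
    by (intro has_bochner_integral_add has_bochner_integral_mult_right gaussian_linear_linear
        gaussian_linear_quadratic gaussian_quadratic_quadratic assms)
  moreover have "r * ((p + s / 2) * (q + t / 2)) =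
      r * (p * q) + 1 / 2 * (r * (p * t)) + 1 / 2 * (r * (q * s)) + 1 / 4 * (r * (s * t))"
    for p q r s t :: real
    by (simp add: field_simps)
  ultimately show ?thesis by simp
qed

section \<open>Whitening\<close>

lemma lborel_integral_affine:
  fixes A :: "real^'n^'n" and h :: "real^'n \<Rightarrow> real"
  assumes "invertible A" and [measurable]: "h \<in> borel_measurable borel"
  shows "(\<integral>x. h x \<partial>lborel) = (\<integral>z. \<bar>det A\<bar> * h (\<mu> + A *v z) \<partial>lborel)"
proof -
  have "det A \<noteq> 0" using assms(1) invertible_det_nz by blast
  have "(\<integral>x. h x \<partial>lborel) = (\<integral>x. h (\<mu> + x) \<partial>lborel)"
    by (subst lborel_distr_plus[of \<mu>, symmetric]) (simp add: integral_distr)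
  also have "\<dots> = (\<integral>z. \<bar>det A\<bar> * h (\<mu> + A *v z) \<partial>lborel)"
    by (subst lborel_linear_image[OF \<open>det A \<noteq> 0\<close>]) (simp add: integral_density integral_distr)
  finally show ?thesis .
qed

lemma det_congruence: "det (A ** transpose A) = (det A)\<^sup>2" for A :: "real^'n^'n"
  by (simp add: det_mul power2_eq_square)

text \<open>The substitution \<open>x = \<mu> + A z\<close> turns the quadratic form of \<open>(A A\<^sup>T)\<inverse>\<close> into \<open>z \<bullet> z\<close>, and its Jacobian cancels
  the factor \<open>sqrt (det (A A\<^sup>T)) = \<bar>det A\<bar>\<close> of the normalization.\<close>

lemma gaussian_density_whitened:
  fixes A :: "real^'n^'n"
  assumes "invertible A"
  shows "\<bar>det A\<bar> * gaussian_density (\<mu>, A ** transpose A) (\<mu> + A *v z) = std_gaussian_density z"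
proof -
  have nz: "det A \<noteq> 0" using assms invertible_det_nz by blast
  have "(A *v z) \<bullet> (matrix_inv (A ** transpose A) *v (A *v z)) = z \<bullet> z"
  proof -
    have "matrix_inv (A ** transpose A) *v (A *v z) = transpose (matrix_inv A) *v z"
      by (simp add: matrix_inv_mult matrix_inv_transpose assms transpose_invertible matrix_vector_mul_assoc
          matrix_mul_assoc[symmetric] matrix_inv_left del: transpose_matrix_vector)
    then show ?thesis
      by (simp add: inner_matrix_vector_transpose[symmetric] inner_commute[of "A *v z"]
        matrix_vector_mul_assoc matrix_inv_left assms del: transpose_matrix_vector)
  qed
  moreover have "std_gaussian_density z = exp (- (z \<bullet> z) / 2) / sqrt ((2 * pi) ^ CARD('n))"
    by (simp add: std_gaussian_density_def std_normal_density_def prod_dividef exp_sum[symmetric]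
        inner_vec_def power2_eq_square sum_negf sum_divide_distrib real_sqrt_power real_sqrt_mult power_mult_distrib prod.distrib)
  ultimately show ?thesis
    using nz by (simp add: gaussian_density_def det_congruence real_sqrt_mult)
qed

lemma integral_gaussian_whitened:
  fixes A :: "real^'n^'n"
  assumes "invertible A" and [measurable]: "h \<in> borel_measurable borel"
  shows "(\<integral>x. h x \<partial>gaussian (\<mu>, A ** transpose A)) =
    (\<integral>z. std_gaussian_density z * h (\<mu> + A *v z) \<partial>lborel)"
proof -
  let ?p = "gaussian_density (\<mu>, A ** transpose A)"
  have [measurable]: "(\<lambda>x. M *v (x - \<mu>)) \<in> borel_measurable borel" for M :: "real^'n^'n"
    by (rule measurable_compose[OF _ measurable_matrix_vector_mult]) simp
  have [measurable]: "?p \<in> borel_measurable borel"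
    unfolding gaussian_density_def prod.case by measurable
  have "(\<integral>x. h x \<partial>gaussian (\<mu>, A ** transpose A)) = (\<integral>x. ?p x * h x \<partial>lborel)"
    unfolding distr_of_def
    by (subst integral_density) (auto simp: gaussian_density_def det_congruence)
  also have "\<dots> = (\<integral>z. \<bar>det A\<bar> * (?p (\<mu> + A *v z) * h (\<mu> + A *v z)) \<partial>lborel)"
    by (rule lborel_integral_affine[OF assms(1)]) simp
  also have "\<dots> = (\<integral>z. std_gaussian_density z * h (\<mu> + A *v z) \<partial>lborel)"
    by (simp only: mult.assoc[symmetric] gaussian_density_whitened[OF assms(1)])
  finally show ?thesis .
qed

section \<open>Score and Fisher information of the Gaussian family\<close>

lemma bounded_bilinear_matrix_vector_mult:
  "bounded_bilinear ((*v) :: real^'n^'m \<Rightarrow> real^'n \<Rightarrow> real^'m)"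
  unfolding bilinear_conv_bounded_bilinear[symmetric] bilinear_def
  by (auto intro!: linearI simp: matrix_vector_mult_def vec_eq_iff algebra_simps sum.distrib sum_distrib_left)

text \<open>A covariance direction \<open>S\<close> at \<open>A A\<^sup>T\<close> is \<open>A B A\<^sup>T\<close> for a unique \<open>B\<close>, which is the direction seen in
  whitened coordinates.\<close>

definition whiten :: "real^'n^'n \<Rightarrow> real^'n^'n \<Rightarrow> real^'n^'n" where
  "whiten A S = matrix_inv A ** S ** transpose (matrix_inv A)"

lemma whiten_congruence:
  assumes "invertible A"
  shows "whiten A (A ** X ** transpose A) = X"
proof -
  have "whiten A (A ** X ** transpose A) =
      (matrix_inv A ** A) ** X ** (transpose A ** transpose (matrix_inv A))"
    by (simp only: whiten_def matrix_mul_assoc)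
  then show ?thesis
    by (simp add: matrix_transpose_mul[symmetric] matrix_inv_left assms)
qed

lemma congruence_whiten:
  assumes "invertible A"
  shows "A ** whiten A S ** transpose A = S"
proof -
  have "A ** whiten A S ** transpose A =
      (A ** matrix_inv A) ** S ** (transpose (matrix_inv A) ** transpose A)"
    by (simp only: whiten_def matrix_mul_assoc)
  then show ?thesis
    by (simp add: matrix_transpose_mul[symmetric] matrix_inv_right assms)
qed

lemma transpose_congruence: "transpose (C ** X ** transpose C) = C ** transpose X ** transpose C"
  for C X :: "real^'n^'n"
  by (simp add: matrix_transpose_mul matrix_mul_assoc)

lemma transpose_whiten: "transpose (whiten A S) = whiten A (transpose S)"
  unfolding whiten_def by (rule transpose_congruence)

lemma matrix_inv_congruence:
  fixes A :: "real^'n^'n"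
  assumes "invertible A"
  shows "matrix_inv (A ** transpose A) = transpose (matrix_inv A) ** matrix_inv A"
  by (simp add: matrix_inv_mult matrix_inv_transpose assms transpose_invertible)

lemma inner_matrix_inv_congruence:
  fixes A :: "real^'n^'n"
  assumes "invertible A"
  shows "y \<bullet> (matrix_inv (A ** transpose A) *v u) = (matrix_inv A *v y) \<bullet> (matrix_inv A *v u)"
  by (simp add: matrix_inv_congruence[OF assms] inner_matrix_vector_transpose matrix_vector_mul_assoc
      del: transpose_matrix_vector)

text \<open>Along \<open>t \<mapsto> (\<mu> + t u, \<Sigma> + t S)\<close> the log-density is, up to a constant, minus half of a quadratic
  form, whose derivative comes from that of the inverse, minus half of the logarithm of
  \<open>det (\<Sigma> + t S) = (det A)\<^sup>2 det (I + t B)\<close>, whose derivative at \<open>0\<close> is \<open>tr B\<close>.\<close>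

lemma score_gaussian:
  fixes A :: "real^'n^'n" and x \<mu> u :: "real^'n"
  assumes A: "invertible A"
  defines "z \<equiv> matrix_inv A *v (x - \<mu>)"
  shows "score gaussian_density (\<mu>, A ** transpose A) x (u, S) =
    (matrix_inv A *v u) \<bullet> z + (z \<bullet> (whiten A S *v z) - trace (whiten A S)) / 2"
proof -
  let ?\<Sigma> = "A ** transpose A" and ?B = "whiten A S"
  let ?N = "matrix_inv ?\<Sigma>"
  let ?y = "\<lambda>t. x - (\<mu> + t *\<^sub>R u)"
  let ?q = "\<lambda>t. ?y t \<bullet> (matrix_inv (?\<Sigma> + t *\<^sub>R S) *v ?y t)"
  let ?c = "(2 * pi) ^ CARD('n) :: real"
  let ?d = "\<lambda>t. ?c * ((det A)\<^sup>2 * det (mat 1 + t *\<^sub>R ?B))"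
  have nz: "det A \<noteq> 0" using A invertible_det_nz by blast
  have inv: "invertible ?\<Sigma>" using A by (simp add: invertible_mult transpose_invertible)
  have S: "A ** ?B ** transpose A = S" by (rule congruence_whiten[OF A])
  have det: "det (?\<Sigma> + t *\<^sub>R S) = (det A)\<^sup>2 * det (mat 1 + t *\<^sub>R ?B)" for t
  proof -
    have "?\<Sigma> + t *\<^sub>R S = A ** (mat 1 + t *\<^sub>R ?B) ** transpose A"
      using S by (simp add: matrix_mult_simps)
    then show ?thesis by (simp add: det_mul power2_eq_square)
  qed
  have d_deriv: "(?d has_field_derivative ?c * ((det A)\<^sup>2 * trace ?B)) (at 0)"
    by (intro DERIV_cmult has_field_derivative_det_identity)
  have d0: "?d 0 = ?c * (det A)\<^sup>2" by simp
  have d_pos: "?d 0 > 0" using nz by simp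
  have "((\<lambda>t. ?\<Sigma> + t *\<^sub>R S) has_vector_derivative S) (at 0)"
    by (auto intro!: derivative_eq_intros)
  from has_vector_derivative_matrix_inv[OF this]
  have N_deriv: "((\<lambda>t. matrix_inv (?\<Sigma> + t *\<^sub>R S)) has_vector_derivative - (?N ** S ** ?N)) (at 0)"
    using inv by simp
  have y_deriv: "(?y has_vector_derivative - u) (at 0)"
    by (auto intro!: derivative_eq_intros)
  have "(?q has_vector_derivative
      ?y 0 \<bullet> (matrix_inv (?\<Sigma> + 0 *\<^sub>R S) *v (- u) + - (?N ** S ** ?N) *v ?y 0)
      + (- u) \<bullet> (matrix_inv (?\<Sigma> + 0 *\<^sub>R S) *v ?y 0)) (at 0)"
    by (intro bounded_bilinear.has_vector_derivative[OF bounded_bilinear_inner]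
        bounded_bilinear.has_vector_derivative[OF bounded_bilinear_matrix_vector_mult] y_deriv N_deriv)
  also have "?y 0 \<bullet> (matrix_inv (?\<Sigma> + 0 *\<^sub>R S) *v (- u) + - (?N ** S ** ?N) *v ?y 0)
      + (- u) \<bullet> (matrix_inv (?\<Sigma> + 0 *\<^sub>R S) *v ?y 0)
      = - 2 * ((matrix_inv A *v u) \<bullet> z) - z \<bullet> (?B *v z)"
  proof -
    have 1: "(x - \<mu>) \<bullet> (?N *v u) = (matrix_inv A *v u) \<bullet> z" "u \<bullet> (?N *v (x - \<mu>)) = (matrix_inv A *v u) \<bullet> z"
      by (simp_all add: inner_matrix_inv_congruence[OF A] z_def inner_commute)
    have "?N ** S ** ?N = transpose (matrix_inv A) ** ?B ** transpose (transpose (matrix_inv A))"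
      by (simp add: matrix_inv_congruence[OF A] whiten_def matrix_mul_assoc)
    then have 2: "(x - \<mu>) \<bullet> ((?N ** S ** ?N) *v (x - \<mu>)) = z \<bullet> (?B *v z)"
      using quadratic_form_congruence[of "x - \<mu>" "transpose (matrix_inv A)" ?B "x - \<mu>"]
      by (simp only: transpose_transpose z_def)
    have neg: "- M *v v = - (M *v v)" "M *v - v = - (M *v v)" for M :: "real^'n^'n" and v
      by (simp_all add: bounded_bilinear.minus_left[OF bounded_bilinear_matrix_vector_mult]
        bounded_bilinear.minus_right[OF bounded_bilinear_matrix_vector_mult])
    show ?thesis using 1 2 by (simp add: neg inner_diff_right)
  qed
  finally have q_deriv: "(?q has_field_derivative - 2 * ((matrix_inv A *v u) \<bullet> z) - z \<bullet> (?B *v z)) (at 0)"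
    by (simp add: has_real_derivative_iff_has_vector_derivative)
  have "((\<lambda>t. ln (?d t)) has_field_derivative 1 / ?d 0 * (?c * ((det A)\<^sup>2 * trace ?B))) (at 0)"
    by (rule DERIV_chain2[OF DERIV_ln_divide[OF d_pos] d_deriv])
  then have "((\<lambda>t. ln (?d t)) has_field_derivative trace ?B) (at 0)"
    using nz by simp
  from DERIV_diff[OF DERIV_cdivide[OF DERIV_minus[OF q_deriv], of 2] DERIV_cdivide[OF this, of 2]]
  have ln_deriv: "((\<lambda>t. - ?q t / 2 - ln (?d t) / 2) has_field_derivative
      (matrix_inv A *v u) \<bullet> z + (z \<bullet> (?B *v z) - trace ?B) / 2) (at 0)"
    by (rule DERIV_cong) (simp add: field_simps)
  (* The formula for the log-density needs a positive determinant, hence holds only near 0. *)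
  have "isCont ?d 0" using d_deriv by (rule DERIV_isCont)
  then have "(?d \<longlongrightarrow> ?d 0) (nhds 0)"
    unfolding isCont_def by (rule tendsto_at_iff_tendsto_nhds[THEN iffD1])
  then have "\<forall>\<^sub>F t in nhds 0. ?d t > 0"
    using d_pos by (rule order_tendstoD)
  then have ev: "\<forall>\<^sub>F t in nhds 0. ln (gaussian_density ((\<mu>, ?\<Sigma>) + t *\<^sub>R (u, S)) x) = - ?q t / 2 - ln (?d t) / 2"
  proof eventually_elim
    case (elim t)
    have "gaussian_density ((\<mu>, ?\<Sigma>) + t *\<^sub>R (u, S)) x = exp (- ?q t / 2) / sqrt (?d t)"
      by (simp add: gaussian_density_def det)
    moreover have "ln (exp a / sqrt b) = a - ln b / 2" if "b > 0" for a b :: real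
      using that by (simp add: ln_div ln_sqrt)
    ultimately show ?case using elim by (simp only:)
  qed
  have "((\<lambda>t. ln (gaussian_density ((\<mu>, ?\<Sigma>) + t *\<^sub>R (u, S)) x)) has_field_derivative
      (matrix_inv A *v u) \<bullet> z + (z \<bullet> (?B *v z) - trace ?B) / 2) (at 0)"
    using DERIV_cong_ev[OF refl ev refl] ln_deriv by blast
  then show ?thesis
    unfolding score_def dir_deriv_def by (rule DERIV_imp_deriv)
qed

lemma fisher_information_gaussian:
  fixes A :: "real^'n^'n" and \<mu> u v :: "real^'n"
  assumes A: "invertible A" and "transpose T = T"
  shows "fisher_information gaussian_density (\<mu>, A ** transpose A) (u, S) (v, T) =
    (matrix_inv A *v u) \<bullet> (matrix_inv A *v v) + trace (whiten A S ** whiten A T) / 2"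
proof -
  let ?s = "\<lambda>x. score gaussian_density (\<mu>, A ** transpose A) x"
  have [measurable]: "(\<lambda>x. M *v (g x)) \<in> borel_measurable borel"
    if "g \<in> borel_measurable borel" for M :: "real^'n^'n" and g :: "real^'n \<Rightarrow> real^'n"
    by (rule measurable_compose[OF that measurable_matrix_vector_mult])
  have meas: "(\<lambda>x. ?s x (u, S) * ?s x (v, T)) \<in> borel_measurable borel"
    unfolding score_gaussian[OF A] by measurable
  have z: "matrix_inv A *v (\<mu> + A *v z - \<mu>) = z" for z
    by (simp add: matrix_vector_mul_assoc matrix_inv_left A)
  have "transpose (whiten A T) = whiten A T"
    using assms(2) by (simp add: transpose_whiten)
  from has_bochner_integral_integral_eq[OF gaussian_score_covariance[OF this]]
  show ?thesis
    unfolding fisher_information_def integral_gaussian_whitened[OF A meas]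
    unfolding score_gaussian[OF A] z by simp
qed

section \<open>The natural gradient\<close>

text \<open>Since \<open>v\<^sup>T C v - tr C = tr ((v v\<^sup>T - I) C)\<close>, the weighted sum of the scores is the Fisher pairing of
  the whitened direction \<open>(v, C)\<close> with \<open>(G, M)\<close>.  The Fisher form is positive definite on symmetric
  directions, so this determines the gradient.\<close>

lemma natural_gradient_gaussian:
  fixes A :: "real^'n^'n" and \<mu> :: "real^'n" and x :: "nat \<Rightarrow> real^'n" and \<omega> :: "nat \<Rightarrow> real" and N :: nat
  assumes A: "invertible A"
  defines "z \<equiv> \<lambda>i. matrix_inv A *v (x i - \<mu>)"
  defines "G \<equiv> \<Sum>i=1..N. \<omega> i *\<^sub>R z i"
  defines "M \<equiv> \<Sum>i=1..N. \<omega> i *\<^sub>R ((\<chi> j k. z i $ j * z i $ k) - mat 1)"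
  shows "natural_gradient gaussian_density (UNIV \<times> sym_matrices) N \<omega> x (\<mu>, A ** transpose A) =
      (A *v G, A ** M ** transpose A)"
    and "transpose M = M"
proof -
  show M_sym: "transpose M = M"
  proof -
    have "M $ i $ j = M $ j $ i" for i j
      by (cases "i = j") (simp_all add: M_def mat_def mult.commute)
    then show ?thesis by (simp add: transpose_def vec_eq_iff)
  qed
  have rhs: "(\<Sum>i=1..N. \<omega> i * score gaussian_density (\<mu>, A ** transpose A) (x i) (u, S)) =
      (matrix_inv A *v u) \<bullet> G + trace (M ** whiten A S) / 2" for u S
  proof -
    let ?C = "whiten A S"
    have outer: "trace (((\<chi> j k. v $ j * v $ k) - mat 1) ** C) = v \<bullet> (C *v v) - trace C"
      for v :: "real^'n" and C :: "real^'n^'n"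
    proof -
      have "trace ((\<chi> j k. v $ j * v $ k) ** C) = (\<Sum>j\<in>UNIV. \<Sum>k\<in>UNIV. v $ j * v $ k * C $ k $ j)"
        by (simp add: trace_def matrix_matrix_mult_def)
      also have "\<dots> = (\<Sum>k\<in>UNIV. \<Sum>j\<in>UNIV. v $ j * v $ k * C $ k $ j)" by (rule sum.swap)
      also have "\<dots> = v \<bullet> (C *v v)"
        by (simp add: inner_vec_def matrix_vector_mult_def sum_distrib_left mult_ac)
      finally show ?thesis by (simp add: matrix_mult_simps trace_sub)
    qed
    have "trace (M ** ?C) = (\<Sum>i=1..N. \<omega> i * (z i \<bullet> (?C *v z i) - trace ?C))"
      unfolding M_def bounded_bilinear.sum_left[OF bounded_bilinear_matrix_mult] linear_sum[OF linear_trace]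
      by (simp only: matrix_mult_simps trace_scaleR outer[symmetric]) 
    moreover have "score gaussian_density (\<mu>, A ** transpose A) (x i) (u, S) =
        (matrix_inv A *v u) \<bullet> z i + (z i \<bullet> (?C *v z i) - trace ?C) / 2" for i
      unfolding score_gaussian[OF A] z_def ..
    ultimately show ?thesis
      by (simp add: G_def inner_sum_right distrib_left sum.distrib sum_divide_distrib)
  qed
  show "natural_gradient gaussian_density (UNIV \<times> sym_matrices) N \<omega> x (\<mu>, A ** transpose A) =
      (A *v G, A ** M ** transpose A)"
    unfolding natural_gradient_def
  proof (rule the_equality, intro conjI ballI)
    show "(A *v G, A ** M ** transpose A) \<in> UNIV \<times> sym_matrices"
      by (simp add: sym_matrices_def transpose_congruence M_sym)
  next
    fix h :: "(real^'n) \<times> (real^'n^'n)" assume "h \<in> UNIV \<times> sym_matrices"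
    then obtain v T where h: "h = (v, T)" "transpose T = T"
      by (auto simp: sym_matrices_def)
    show "fisher_information gaussian_density (\<mu>, A ** transpose A) (A *v G, A ** M ** transpose A) h =
        (\<Sum>i=1..N. \<omega> i * score gaussian_density (\<mu>, A ** transpose A) (x i) h)"
      unfolding h(1) rhs fisher_information_gaussian[OF A h(2)]
      by (simp add: whiten_congruence[OF A] inner_commute matrix_vector_mul_assoc matrix_inv_left[OF A])
  next
    fix Y :: "(real^'n) \<times> (real^'n^'n)"
    assume Y: "Y \<in> UNIV \<times> sym_matrices \<and> (\<forall>h\<in>UNIV \<times> sym_matrices.
      fisher_information gaussian_density (\<mu>, A ** transpose A) Y h =
      (\<Sum>i=1..N. \<omega> i * score gaussian_density (\<mu>, A ** transpose A) (x i) h))"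
    obtain u S where uS: "Y = (u, S)" "transpose S = S"
      using Y by (cases Y) (auto simp: sym_matrices_def)
    (* Testing the defining equation against the difference to the expected gradient shows that the
       squared Fisher norm of this difference vanishes. *)
    let ?e = "matrix_inv A *v u - G" and ?D = "whiten A S - M"
    have D_sym: "transpose ?D = ?D"
      by (simp add: transpose_diff transpose_whiten M_sym uS)

    have h_sym: "transpose (A ** ?D ** transpose A) = A ** ?D ** transpose A"
      by (simp add: transpose_congruence D_sym)
    then have "(A *v ?e, A ** ?D ** transpose A) \<in> UNIV \<times> sym_matrices"
      by (simp add: sym_matrices_def)
    with Y have "fisher_information gaussian_density (\<mu>, A ** transpose A) Y (A *v ?e, A ** ?D ** transpose A) =
      (\<Sum>i=1..N. \<omega> i * score gaussian_density (\<mu>, A ** transpose A) (x i) (A *v ?e, A ** ?D ** transpose A))"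
      by blast
    then have "(matrix_inv A *v u) \<bullet> ?e + trace (whiten A S ** ?D) / 2 = ?e \<bullet> G + trace (M ** ?D) / 2"
      unfolding uS(1) rhs fisher_information_gaussian[OF A h_sym] whiten_congruence[OF A]
      by (simp add: matrix_vector_mul_assoc matrix_inv_left[OF A])
    moreover have "?e \<bullet> ?e = (matrix_inv A *v u) \<bullet> ?e - ?e \<bullet> G"
      by (metis inner_commute inner_diff_left)
    moreover have "trace (?D ** ?D) = trace (whiten A S ** ?D) - trace (M ** ?D)"
      by (simp only: bounded_bilinear.diff_left[OF bounded_bilinear_matrix_mult] trace_sub)
    ultimately have "?e \<bullet> ?e + trace (?D ** ?D) / 2 = 0" by argo
    then have "?e \<bullet> ?e + (?D \<bullet> ?D) / 2 = 0"
      by (simp only: trace_mult_self_symmetric[OF D_sym])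
    then have "?e \<bullet> ?e = 0 \<and> ?D \<bullet> ?D = 0"
      using inner_ge_zero[of ?e] inner_ge_zero[of ?D] by linarith
    then have "matrix_inv A *v u = G" "whiten A S = M" by simp_all
    then have "u = A *v G" "S = A ** M ** transpose A"
      using congruence_whiten[OF A, of S]
      by (auto simp: matrix_vector_mul_assoc matrix_inv_right[OF A])
    then show "Y = (A *v G, A ** M ** transpose A)" by (simp add: uS)
  qed
qed

section \<open>Geodesics\<close>

lemma geodesic_fromI:
  assumes "\<gamma> 0 = p" "\<gamma>' 0 = v" "\<And>t. t \<in> {0..1} \<Longrightarrow> \<gamma> t \<in> M"
    and "\<And>t. (\<gamma> has_vector_derivative \<gamma>' t) (at t within {0..1})"
    and "\<And>t. (\<gamma>' has_vector_derivative \<gamma>'' t) (at t within {0..1})"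
    and "\<And>t. t \<in> {0..1} \<Longrightarrow> \<forall>h\<in>T. g (\<gamma> t) (\<gamma>'' t) h + christoffel g (\<gamma> t) (\<gamma>' t) (\<gamma>' t) h = 0"
  shows "geodesic_from M T g p v \<gamma>"
  unfolding geodesic_from_def using assms by blast

lemma geodesic_fromE:
  assumes "geodesic_from M T g p v \<gamma>"
  obtains \<gamma>' \<gamma>'' where "\<gamma> 0 = p" "\<gamma>' 0 = v" "\<And>t. t \<in> {0..1} \<Longrightarrow> \<gamma> t \<in> M"
    and "\<And>t. t \<in> {0..1} \<Longrightarrow> (\<gamma> has_vector_derivative \<gamma>' t) (at t within {0..1})"
    and "\<And>t. t \<in> {0..1} \<Longrightarrow> (\<gamma>' has_vector_derivative \<gamma>'' t) (at t within {0..1})"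
    and "\<And>t. t \<in> {0..1} \<Longrightarrow> \<forall>h\<in>T. g (\<gamma> t) (\<gamma>'' t) h + christoffel g (\<gamma> t) (\<gamma>' t) (\<gamma>' t) h = 0"
proof -
  from assms obtain \<gamma>' \<gamma>'' where "\<gamma> 0 = p" "\<gamma>' 0 = v"
    and *: "\<forall>t\<in>{0..1}. \<gamma> t \<in> M \<and>
           (\<gamma> has_vector_derivative \<gamma>' t) (at t within {0..1}) \<and>
           (\<gamma>' has_vector_derivative \<gamma>'' t) (at t within {0..1}) \<and>
           (\<forall>h\<in>T. g (\<gamma> t) (\<gamma>'' t) h + christoffel g (\<gamma> t) (\<gamma>' t) (\<gamma>' t) h = 0)"
    unfolding geodesic_from_def by (elim conjE exE)
  show thesis
    by (rule that[of \<gamma>' \<gamma>'', OF \<open>\<gamma> 0 = p\<close> \<open>\<gamma>' 0 = v\<close>]) (drule bspec[OF *], elim conjE, assumption)+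
qed

lemma zero_derivative_unit_interval:
  fixes f :: "real \<Rightarrow> 'a::real_normed_vector"
  assumes "\<And>t. t \<in> {0..1} \<Longrightarrow> (f has_vector_derivative 0) (at t within {0..1})" and "t \<in> {0..1}"
  shows "f t = f 0"
  using has_vector_derivative_zero_constant[OF convex_real_interval(5) assms(1)] assms(2)
  by (metis atLeastAtMost_iff order_refl zero_le_one)

lemma riemannian_exp_eqI:
  assumes "geodesic_from M T g p v \<gamma>" "\<gamma> 1 = q"
    and "\<And>\<gamma>. geodesic_from M T g p v \<gamma> \<Longrightarrow> \<gamma> 1 = q"
  shows "riemannian_exp M T g p v = q"
  unfolding riemannian_exp_def using assms by (intro the_equality) auto

text \<open>With the covariance held fixed the metric is constant, so geodesics are affine.\<close>

lemma christoffel_mean: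
  "christoffel gaussian_fisher_metric (m, \<Sigma>) (a, 0) (b, 0) (c, 0) = 0"
  by (simp add: christoffel_def dir_deriv_def gaussian_fisher_metric_def)

lemma gaussian_fisher_metric_mean:
  "gaussian_fisher_metric (m, \<Sigma>) (a, 0) (b, 0) = a \<bullet> (matrix_inv \<Sigma> *v b)"
  by (simp add: gaussian_fisher_metric_def matrix_mult_simps trace_def)

lemma has_vector_derivative_snd:
  "(f has_vector_derivative D) F \<Longrightarrow> ((\<lambda>t. snd (f t)) has_vector_derivative snd D) F"
  by (rule bounded_linear.has_vector_derivative[OF bounded_linear_snd])

text \<open>Used to confine velocity and acceleration of a curve to the tangent space of the block that
  contains the curve.\<close>

lemma vector_derivative_in_subspace:
  fixes f :: "real \<Rightarrow> 'a::real_normed_vector" and L :: "'a \<Rightarrow> 'b::real_normed_vector"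
  assumes L: "bounded_linear L" and f: "(f has_vector_derivative D) (at t within {0..1})"
    and t: "t \<in> {0..1}" and const: "\<And>s. s \<in> {0..1} \<Longrightarrow> L (f s) = c"
  shows "L D = 0"
proof -
  have "((\<lambda>s. L (f s)) has_vector_derivative L D) (at t within {0..1})"
    by (rule bounded_linear.has_vector_derivative[OF L f])
  then have "((\<lambda>s. c) has_vector_derivative L D) (at t within {0..1})"
    by (rule has_vector_derivative_transform[OF t, rotated]) (simp add: const)
  then show ?thesis
    using vector_derivative_unique_within_closed_interval[of 0 1 t "\<lambda>_. c" "L D" 0] t by simp
qed

text \<open>Paired with \<open>(\<Sigma> b, 0)\<close>, an acceleration \<open>(b, 0)\<close> has inner product \<open>b \<bullet> b\<close>, so the geodesic equation
  forces it to vanish.\<close>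

lemma riemannian_exp_mean:
  fixes \<mu> v :: "real^'n" and \<Sigma> :: "real^'n^'n"
  assumes "invertible \<Sigma>"
  shows "riemannian_exp (UNIV \<times> {\<Sigma>}) (UNIV \<times> {0}) gaussian_fisher_metric (\<mu>, \<Sigma>) (v, 0) = (\<mu> + v, \<Sigma>)"
proof (rule riemannian_exp_eqI)
  let ?\<gamma> = "\<lambda>t::real. (\<mu> + t *\<^sub>R v, \<Sigma>)"
  show "geodesic_from (UNIV \<times> {\<Sigma>}) (UNIV \<times> {0}) gaussian_fisher_metric (\<mu>, \<Sigma>) (v, 0) ?\<gamma>"
  proof (rule geodesic_fromI[where \<gamma>'="\<lambda>_. (v, 0)" and \<gamma>''="\<lambda>_. (0, 0)"])
    show "(?\<gamma> has_vector_derivative (v, 0)) (at t within {0..1})" for t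
      by (auto intro!: has_vector_derivative_Pair derivative_eq_intros)
    show "((\<lambda>_. (v, 0)) has_vector_derivative (0, 0)) (at t within {0..1})" for t
      by (simp add: zero_prod_def[symmetric])
  qed (auto simp: gaussian_fisher_metric_mean christoffel_mean)
  show "?\<gamma> 1 = (\<mu> + v, \<Sigma>)" by simp
next
  fix \<gamma>
  assume "geodesic_from (UNIV \<times> {\<Sigma>}) (UNIV \<times> {0}) gaussian_fisher_metric (\<mu>, \<Sigma>) (v, 0) \<gamma>"
  then obtain \<gamma>' \<gamma>'' where start: "\<gamma> 0 = (\<mu>, \<Sigma>)" "\<gamma>' 0 = (v, 0)"
    and M: "\<And>t. t \<in> {0..1} \<Longrightarrow> \<gamma> t \<in> UNIV \<times> {\<Sigma>}"
    and d1: "\<And>t. t \<in> {0..1} \<Longrightarrow> (\<gamma> has_vector_derivative \<gamma>' t) (at t within {0..1})"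
    and d2: "\<And>t. t \<in> {0..1} \<Longrightarrow> (\<gamma>' has_vector_derivative \<gamma>'' t) (at t within {0..1})"
    and geo: "\<And>t. t \<in> {0..1} \<Longrightarrow> \<forall>h\<in>UNIV \<times> {0}.
      gaussian_fisher_metric (\<gamma> t) (\<gamma>'' t) h + christoffel gaussian_fisher_metric (\<gamma> t) (\<gamma>' t) (\<gamma>' t) h = 0"
    by (rule geodesic_fromE) (rule that; assumption)
  have s0: "snd (\<gamma> t) = \<Sigma>" if "t \<in> {0..1}" for t
    using M[OF that] by auto
  have s1: "snd (\<gamma>' t) = 0" if "t \<in> {0..1}" for t
    by (rule vector_derivative_in_subspace[OF bounded_linear_snd d1[OF that] that s0])
  have s2: "snd (\<gamma>'' t) = 0" if "t \<in> {0..1}" for t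
    by (rule vector_derivative_in_subspace[OF bounded_linear_snd d2[OF that] that s1])
  have f2: "\<gamma>'' t = 0" if t: "t \<in> {0..1}" for t
  proof -
    obtain m a b where eq: "\<gamma> t = (m, \<Sigma>)" "\<gamma>' t = (a, 0)" "\<gamma>'' t = (b, 0)"
      using s0[OF t] s1[OF t] s2[OF t] by (metis prod.collapse)
    have "b \<bullet> (matrix_inv \<Sigma> *v (\<Sigma> *v b)) = 0"
      using bspec[OF geo[OF t], of "(\<Sigma> *v b, 0)"]
      by (simp add: eq gaussian_fisher_metric_mean christoffel_mean)
    then have "b = 0"
      by (simp add: matrix_vector_mul_assoc matrix_inv_left assms)
    with eq(3) show ?thesis by (simp add: zero_prod_def)
  qed
  have "(\<gamma>' has_vector_derivative 0) (at t within {0..1})" if "t \<in> {0..1}" for t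
    using d2[OF that] f2[OF that] by simp
  then have f1: "\<gamma>' t = (v, 0)" if "t \<in> {0..1}" for t
    using zero_derivative_unit_interval[OF _ that] start(2) by metis
  have line: "((\<lambda>t. \<gamma> t - t *\<^sub>R (v, 0)) has_vector_derivative 0) (at t within {0..1})" if "t \<in> {0..1}" for t
    using d1[OF that] unfolding f1[OF that] by (auto intro!: derivative_eq_intros)
  have "\<gamma> 1 - 1 *\<^sub>R (v, 0) = \<gamma> 0 - 0 *\<^sub>R (v, 0)"
    by (rule zero_derivative_unit_interval[OF line]) simp_all
  with start(1) show "\<gamma> 1 = (\<mu> + v, \<Sigma>)"
    by (simp add: prod_eq_iff algebra_simps)
qed

lemma gaussian_fisher_metric_cov:
  "gaussian_fisher_metric (m, \<Sigma>) (0, X) (0, Y) = trace (X ** matrix_inv \<Sigma> ** Y ** matrix_inv \<Sigma>) / 2"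
  by (simp add: gaussian_fisher_metric_def Let_def)

text \<open>The metric depends on the point through two factors \<open>\<Sigma>\<inverse>\<close>, each with derivative
  \<open>- \<Sigma>\<inverse> Z \<Sigma>\<inverse>\<close> in the direction \<open>Z\<close>.\<close>

lemma dir_deriv_fisher_metric_cov:
  fixes \<Sigma> X Y Z :: "real^'n^'n"
  assumes "invertible \<Sigma>"
  defines "P \<equiv> matrix_inv \<Sigma>"
  shows "dir_deriv (\<lambda>q. gaussian_fisher_metric q (0, X) (0, Y)) (m, \<Sigma>) (0, Z) =
    - (trace (X ** P ** Z ** P ** Y ** P) + trace (X ** P ** Y ** P ** Z ** P)) / 2"
proof -
  let ?N = "\<lambda>t. matrix_inv (\<Sigma> + t *\<^sub>R Z)"
  have "((\<lambda>t. \<Sigma> + t *\<^sub>R Z) has_vector_derivative Z) (at 0)"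
    by (auto intro!: derivative_eq_intros)
  from has_vector_derivative_matrix_inv[OF this]
  have N: "(?N has_vector_derivative - (P ** Z ** P)) (at 0)"
    using assms(1) by (simp add: P_def)
  have "((\<lambda>t. X ** ?N t ** (Y ** ?N t)) has_vector_derivative
      X ** ?N 0 ** (Y ** - (P ** Z ** P) + 0 ** ?N 0) + (X ** - (P ** Z ** P) + 0 ** ?N 0) ** (Y ** ?N 0)) (at 0)"
    by (intro has_vector_derivative_matrix_mult has_vector_derivative_const N)
  from bounded_linear.has_vector_derivative[OF linear_conv_bounded_linear[THEN iffD1, OF linear_trace] this]
  have "((\<lambda>t. trace (X ** ?N t ** Y ** ?N t)) has_field_derivative
      - (trace (X ** P ** Z ** P ** Y ** P) + trace (X ** P ** Y ** P ** Z ** P))) (at 0)"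
    unfolding has_real_derivative_iff_has_vector_derivative
    by (simp add: matrix_mult_simps matrix_mul_assoc P_def[symmetric] linear_add[OF linear_trace]
        linear_neg[OF linear_trace] linear_diff[OF linear_trace] add.commute)
  from DERIV_imp_deriv[OF DERIV_cdivide[OF this, of 2]]
  show ?thesis
    unfolding dir_deriv_def by (simp add: gaussian_fisher_metric_cov)
qed

text \<open>By cyclicity of the trace all three directional derivatives in the Koszul formula have the same
  value, and two of them cancel.\<close>

lemma christoffel_cov:
  fixes \<Sigma> X H :: "real^'n^'n"
  assumes "invertible \<Sigma>"
  defines "P \<equiv> matrix_inv \<Sigma>"
  shows "christoffel gaussian_fisher_metric (m, \<Sigma>) (0, X) (0, X) (0, H) = - trace (X ** P ** X ** P ** H ** P) / 2"
proof -
  have cyc1: "trace (X ** P ** H ** P ** X ** P) = trace (X ** P ** X ** P ** H ** P)"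
    using trace_mul_sym[of "X ** P ** H ** P" "X ** P"] by (simp add: matrix_mul_assoc)
  show ?thesis
    unfolding christoffel_def dir_deriv_fisher_metric_cov[OF assms(1)] P_def[symmetric] cyc1
    by simp
qed

text \<open>The geodesic equation of the covariance block is \<open>\<Sigma>'' = \<Sigma>' \<Sigma>\<inverse> \<Sigma>'\<close>; it suffices to test it
  against the symmetric matrix formed by its own residual.\<close>

lemma geodesic_equation_cov:
  fixes \<Sigma> X Y :: "real^'n^'n"
  assumes inv: "invertible \<Sigma>" and sym: "transpose \<Sigma> = \<Sigma>" "transpose X = X" "transpose Y = Y"
  shows "(\<forall>h\<in>{0} \<times> sym_matrices. gaussian_fisher_metric (m, \<Sigma>) (0, Y) h +
      christoffel gaussian_fisher_metric (m, \<Sigma>) (0, X) (0, X) h = 0) \<longleftrightarrow>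
    Y = X ** matrix_inv \<Sigma> ** X"
proof -
  let ?P = "matrix_inv \<Sigma>"
  let ?D = "Y - X ** ?P ** X"
  let ?E = "?P ** ?D ** ?P"
  have P: "transpose ?P = ?P"
    using matrix_inv_transpose[OF inv] sym(1) by simp
  have eq: "gaussian_fisher_metric (m, \<Sigma>) (0, Y) (0, H) +
      christoffel gaussian_fisher_metric (m, \<Sigma>) (0, X) (0, X) (0, H) = trace (?E ** H) / 2" for H
  proof -
    have "trace (?D ** ?P ** H ** ?P) = trace (?E ** H)"
      using trace_mul_sym[of "?D ** ?P ** H" ?P] by (simp add: matrix_mul_assoc)
    then show ?thesis
      unfolding gaussian_fisher_metric_cov christoffel_cov[OF inv]
      by (simp add: matrix_mult_simps trace_sub matrix_mul_assoc)
  qed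
  have D_sym: "transpose ?D = ?D"
    by (simp add: transpose_diff matrix_transpose_mul sym P matrix_mul_assoc)
  have E_sym: "transpose ?E = ?E"
    by (simp add: matrix_transpose_mul D_sym P matrix_mul_assoc)
  have "(\<forall>h\<in>{0} \<times> sym_matrices. gaussian_fisher_metric (m, \<Sigma>) (0, Y) h +
      christoffel gaussian_fisher_metric (m, \<Sigma>) (0, X) (0, X) h = 0) \<longleftrightarrow>
      (\<forall>H\<in>sym_matrices. trace (?E ** H) / 2 = 0)"
    by (auto simp: eq[symmetric])
  also have "\<dots> \<longleftrightarrow> (\<forall>H\<in>sym_matrices. trace (?E ** H) = 0)" by simp
  also have "\<dots> \<longleftrightarrow> ?E = 0"
  proof
    assume "\<forall>H\<in>sym_matrices. trace (?E ** H) = 0"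
    then have "trace (?E ** ?E) = 0" using E_sym by (simp add: sym_matrices_def)
    then show "?E = 0" using trace_mult_self_symmetric[OF E_sym] by simp
  qed (simp add: matrix_mult_simps trace_def)
  also have "\<dots> \<longleftrightarrow> ?D = 0"
  proof
    assume "?E = 0"
    then have "\<Sigma> ** ?E ** \<Sigma> = 0" by (simp add: matrix_mult_simps)
    moreover have "\<Sigma> ** ?E ** \<Sigma> = (\<Sigma> ** ?P) ** ?D ** (?P ** \<Sigma>)" by (simp only: matrix_mul_assoc)
    ultimately show "?D = 0" by (simp only: matrix_inv_left[OF inv] matrix_inv_right[OF inv] matrix_mul_lid matrix_mul_rid)
  qed (simp add: matrix_mult_simps)
  finally show ?thesis by simp
qed

text \<open>The curve \<open>t \<mapsto> A exp (t G) A\<^sup>T\<close> is a geodesic by direct computation.  For an arbitrary geodesic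
  \<open>\<sigma>\<close>, the matrix \<open>W = \<sigma>\<inverse> \<sigma>'\<close> satisfies \<open>W' = \<sigma>\<inverse> \<sigma>'' - \<sigma>\<inverse> \<sigma>' \<sigma>\<inverse> \<sigma>' = 0\<close>.  Hence \<open>\<sigma>' = \<sigma> W\<close> with constant
  \<open>W\<close>, which whitening turns into \<open>F' = F G\<close> for \<open>F = A\<inverse> \<sigma> A\<^sup>-\<^sup>T\<close>, and this linear equation has only
  one solution starting at the identity.\<close>

lemma riemannian_exp_cov:
  fixes \<mu> :: "real^'n" and A G :: "real^'n^'n"
  assumes A: "invertible A" and G: "transpose G = G"
  shows "riemannian_exp ({\<mu>} \<times> spd_matrices) ({0} \<times> sym_matrices) gaussian_fisher_metric
      (\<mu>, A ** transpose A) (0, A ** G ** transpose A) = (\<mu>, A ** matrix_exp G ** transpose A)"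
proof (rule riemannian_exp_eqI)
  let ?E = "\<lambda>t. matrix_exp (t *\<^sub>R G)"
  let ?\<sigma> = "\<lambda>t. A ** ?E t ** transpose A"
  have spd: "?\<sigma> t \<in> spd_matrices" for t
  proof -
    (* A square root of the exponential exhibits the curve in the form B B^T with B invertible. *)
    let ?B = "A ** matrix_exp ((t / 2) *\<^sub>R G)"
    have "?B ** transpose ?B = A ** (matrix_exp ((t / 2) *\<^sub>R G) ** transpose (matrix_exp ((t / 2) *\<^sub>R G))) ** transpose A"
      by (simp only: matrix_transpose_mul matrix_mul_assoc)
    also have "\<dots> = ?\<sigma> t"
      by (simp only: matrix_exp_symmetric_square[OF G])
    finally show ?thesis
      using spd_matrices_congruence[of ?B] A by (simp add: invertible_mult invertible_matrix_exp)
  qed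
  have deriv: "((\<lambda>t. A ** (K ** ?E t) ** transpose A) has_vector_derivative A ** (K ** G ** ?E t) ** transpose A) (at t within S)"
    for K t S
    using has_vector_derivative_matrix_mult[OF has_vector_derivative_matrix_mult[OF has_vector_derivative_const[of A]
        has_vector_derivative_matrix_mult[OF has_vector_derivative_const[of K] has_vector_derivative_matrix_exp[of G t S]]]
        has_vector_derivative_const[of "transpose A"]]
    by (simp add: matrix_mult_simps matrix_mul_assoc)
  have E_sym: "transpose (?E t) = ?E t" for t
    by (simp add: transpose_matrix_exp transpose_scalar G)
  have eq: "A ** (G ** G ** ?E t) ** transpose A =
      A ** (G ** ?E t) ** transpose A ** matrix_inv (?\<sigma> t) ** (A ** (G ** ?E t) ** transpose A)" for t
  proof -
    have inv: "matrix_inv (?\<sigma> t) = matrix_inv (transpose A) ** matrix_inv (?E t) ** matrix_inv A"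
      by (simp add: matrix_inv_mult A transpose_invertible invertible_mult invertible_matrix_exp matrix_mul_assoc)
    have "A ** (G ** ?E t) ** transpose A ** matrix_inv (?\<sigma> t) ** (A ** (G ** ?E t) ** transpose A) =
      A ** G ** (?E t ** (transpose A ** matrix_inv (transpose A)) ** matrix_inv (?E t)) ** (matrix_inv A ** A) ** G ** ?E t ** transpose A"
      by (simp only: inv matrix_mul_assoc)
    then show ?thesis
      by (simp add: matrix_inv_left matrix_inv_right A transpose_invertible invertible_matrix_exp matrix_mul_assoc)
  qed
  show "geodesic_from ({\<mu>} \<times> spd_matrices) ({0} \<times> sym_matrices) gaussian_fisher_metric
      (\<mu>, A ** transpose A) (0, A ** G ** transpose A) (\<lambda>t. (\<mu>, ?\<sigma> t))"
  proof (rule geodesic_fromI[where \<gamma>'="\<lambda>t. (0, A ** (G ** ?E t) ** transpose A)"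
        and \<gamma>''="\<lambda>t. (0, A ** (G ** G ** ?E t) ** transpose A)"])
    fix t :: real
    show "((\<lambda>t. (\<mu>, ?\<sigma> t)) has_vector_derivative (0, A ** (G ** ?E t) ** transpose A)) (at t within {0..1})"
      using deriv[of "mat 1" t "{0..1}"] by (intro has_vector_derivative_Pair) simp_all
    show "((\<lambda>t. (0, A ** (G ** ?E t) ** transpose A)) has_vector_derivative
        (0, A ** (G ** G ** ?E t) ** transpose A)) (at t within {0..1})"
      using deriv[of G t "{0..1}"] by (intro has_vector_derivative_Pair) simp_all
    show "(\<mu>, ?\<sigma> t) \<in> {\<mu>} \<times> spd_matrices" using spd by simp
    have GE: "G ** ?E t = ?E t ** G" by (rule matrix_exp_commute)
    have sym1: "transpose (A ** (G ** ?E t) ** transpose A) = A ** (G ** ?E t) ** transpose A"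
      by (subst transpose_congruence) (simp only: matrix_transpose_mul G E_sym GE)
    have sym2: "transpose (A ** (G ** G ** ?E t) ** transpose A) = A ** (G ** G ** ?E t) ** transpose A"
    proof -
      have "?E t ** (G ** G) = G ** ?E t ** G" by (simp only: matrix_mul_assoc GE)
      also have "\<dots> = G ** (?E t ** G)" by (simp only: matrix_mul_assoc)
      also have "\<dots> = G ** G ** ?E t" by (simp only: GE[symmetric] matrix_mul_assoc)
      finally show ?thesis
        by (subst transpose_congruence) (simp only: matrix_transpose_mul G E_sym)
    qed
    have sym0: "transpose (?\<sigma> t) = ?\<sigma> t" using spd by (simp add: spd_matrices_def)
    show "\<forall>h\<in>{0} \<times> sym_matrices.
        gaussian_fisher_metric (\<mu>, ?\<sigma> t) (0, A ** (G ** G ** ?E t) ** transpose A) h +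
        christoffel gaussian_fisher_metric (\<mu>, ?\<sigma> t) (0, A ** (G ** ?E t) ** transpose A)
          (0, A ** (G ** ?E t) ** transpose A) h = 0"
      unfolding geodesic_equation_cov[OF spd_matrices_invertible[OF spd] sym0 sym1 sym2] by (rule eq)
  qed simp_all
  show "(\<mu>, ?\<sigma> 1) = (\<mu>, A ** matrix_exp G ** transpose A)" by simp
next
  fix \<gamma>
  assume "geodesic_from ({\<mu>} \<times> spd_matrices) ({0} \<times> sym_matrices) gaussian_fisher_metric
      (\<mu>, A ** transpose A) (0, A ** G ** transpose A) \<gamma>"
  then obtain \<gamma>' \<gamma>'' where start: "\<gamma> 0 = (\<mu>, A ** transpose A)" "\<gamma>' 0 = (0, A ** G ** transpose A)"
    and M: "\<And>t. t \<in> {0..1} \<Longrightarrow> \<gamma> t \<in> {\<mu>} \<times> spd_matrices"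
    and d1: "\<And>t. t \<in> {0..1} \<Longrightarrow> (\<gamma> has_vector_derivative \<gamma>' t) (at t within {0..1})"
    and d2: "\<And>t. t \<in> {0..1} \<Longrightarrow> (\<gamma>' has_vector_derivative \<gamma>'' t) (at t within {0..1})"
    and geo: "\<And>t. t \<in> {0..1} \<Longrightarrow> \<forall>h\<in>{0} \<times> sym_matrices.
      gaussian_fisher_metric (\<gamma> t) (\<gamma>'' t) h + christoffel gaussian_fisher_metric (\<gamma> t) (\<gamma>' t) (\<gamma>' t) h = 0"
    by (rule geodesic_fromE) (rule that; assumption)
  define \<sigma> \<sigma>' \<sigma>'' where "\<sigma> t = snd (\<gamma> t)" and "\<sigma>' t = snd (\<gamma>' t)" and "\<sigma>'' t = snd (\<gamma>'' t)" for t
  have f0: "fst (\<gamma> t) = \<mu>" if "t \<in> {0..1}" for t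
    using M[OF that] by auto
  have f1: "fst (\<gamma>' t) = 0" if "t \<in> {0..1}" for t
    by (rule vector_derivative_in_subspace[OF bounded_linear_fst d1[OF that] that f0])
  have f2: "fst (\<gamma>'' t) = 0" if "t \<in> {0..1}" for t
    by (rule vector_derivative_in_subspace[OF bounded_linear_fst d2[OF that] that f1])
  have spd: "\<sigma> t \<in> spd_matrices" if "t \<in> {0..1}" for t
    using M[OF that] by (auto simp: \<sigma>_def)
  note inv = spd_matrices_invertible[OF spd]
  (* The skew part of the curve vanishes identically, hence so do those of its derivatives. *)
  have skew: "bounded_linear (\<lambda>p :: (real^'n) \<times> (real^'n^'n). snd p - transpose (snd p))"
    unfolding linear_conv_bounded_linear[symmetric]
    by (rule linearI) (simp_all add: transpose_def vec_eq_iff algebra_simps)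
  have sym0: "transpose (\<sigma> t) = \<sigma> t" if "t \<in> {0..1}" for t
    using spd[OF that] by (simp add: spd_matrices_def)
  have sym1: "transpose (\<sigma>' t) = \<sigma>' t" if "t \<in> {0..1}" for t
    using vector_derivative_in_subspace[OF skew d1[OF that] that, of 0] sym0 by (simp add: \<sigma>_def \<sigma>'_def)
  have sym2: "transpose (\<sigma>'' t) = \<sigma>'' t" if "t \<in> {0..1}" for t
    using vector_derivative_in_subspace[OF skew d2[OF that] that, of 0] sym1 by (simp add: \<sigma>'_def \<sigma>''_def)
  have ode: "\<sigma>'' t = \<sigma>' t ** matrix_inv (\<sigma> t) ** \<sigma>' t" if t: "t \<in> {0..1}" for t
  proof -
    have "\<gamma> t = (\<mu>, \<sigma> t)" "\<gamma>' t = (0, \<sigma>' t)" "\<gamma>'' t = (0, \<sigma>'' t)"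
      by (simp_all add: prod_eq_iff f0[OF t] f1[OF t] f2[OF t] \<sigma>_def \<sigma>'_def \<sigma>''_def)
    with geo[OF t] show ?thesis
      using geodesic_equation_cov[OF inv[OF t] sym0[OF t] sym1[OF t] sym2[OF t], of \<mu>] by simp
  qed
  have \<sigma>_deriv: "(\<sigma> has_vector_derivative \<sigma>' t) (at t within {0..1})"
    and \<sigma>'_deriv: "(\<sigma>' has_vector_derivative \<sigma>'' t) (at t within {0..1})" if "t \<in> {0..1}" for t
    using has_vector_derivative_snd[OF d1[OF that]] has_vector_derivative_snd[OF d2[OF that]]
    by (simp_all add: \<sigma>_def[abs_def] \<sigma>'_def[abs_def] \<sigma>''_def)
  define W where "W t = matrix_inv (\<sigma> t) ** \<sigma>' t" for t
  have W_deriv: "(W has_vector_derivative 0) (at t within {0..1})" if t: "t \<in> {0..1}" for t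
    using has_vector_derivative_matrix_mult[OF has_vector_derivative_matrix_inv[OF \<sigma>_deriv[OF t] inv[OF t]] \<sigma>'_deriv[OF t]]
    by (simp add: W_def[abs_def] ode[OF t] matrix_mult_simps matrix_mul_assoc)
  have W: "W t = W 0" if "t \<in> {0..1}" for t
    by (rule zero_derivative_unit_interval[OF W_deriv that])
  (* The conserved quantity, read off at time 0. *)
  have W0: "transpose A ** W 0 ** transpose (matrix_inv A) = G"
  proof -
    have "transpose A ** W 0 ** transpose (matrix_inv A) =
      (transpose A ** transpose (matrix_inv A)) ** (matrix_inv A ** A) ** G ** (transpose A ** transpose (matrix_inv A))"
      by (simp add: W_def \<sigma>_def \<sigma>'_def start matrix_inv_congruence[OF A] matrix_mul_assoc)
    then show ?thesis
      by (simp add: matrix_transpose_mul[symmetric] matrix_inv_left A)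
  qed
  have "(\<lambda>t. whiten A (\<sigma> t)) 1 = (\<lambda>t. whiten A (\<sigma> t)) 0 ** matrix_exp (1 *\<^sub>R G)"
  proof (rule linear_matrix_ode_unique[where S="{0..1}"])
    fix t :: real assume t: "t \<in> {0..1}"
    have "\<sigma> t ** W 0 = \<sigma>' t"
      unfolding W[OF t, symmetric] unfolding W_def by (simp add: matrix_mul_assoc matrix_inv_right[OF inv[OF t]])
    have "whiten A (\<sigma> t) ** G = matrix_inv A ** \<sigma> t ** (transpose (matrix_inv A) ** transpose A) ** W 0 ** transpose (matrix_inv A)"
      by (simp only: whiten_def W0[symmetric] matrix_mul_assoc)
    also have "\<dots> = matrix_inv A ** (\<sigma> t ** W 0) ** transpose (matrix_inv A)"
      by (simp add: matrix_transpose_mul[symmetric] matrix_inv_right A matrix_mul_assoc)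
    also have "\<dots> = whiten A (\<sigma>' t)"
      by (simp only: whiten_def \<open>\<sigma> t ** W 0 = \<sigma>' t\<close>)
    finally have "whiten A (\<sigma> t) ** G = whiten A (\<sigma>' t)" .
    moreover have "((\<lambda>t. whiten A (\<sigma> t)) has_vector_derivative whiten A (\<sigma>' t)) (at t within {0..1})"
      using has_vector_derivative_matrix_mult[OF has_vector_derivative_matrix_mult[OF has_vector_derivative_const[of "matrix_inv A"]
          \<sigma>_deriv[OF t]] has_vector_derivative_const[of "transpose (matrix_inv A)"]]
      by (simp add: whiten_def matrix_mult_simps)
    ultimately show "((\<lambda>t. whiten A (\<sigma> t)) has_vector_derivative whiten A (\<sigma> t) ** G) (at t within {0..1})"
      by simp
  qed auto
  moreover have "whiten A (\<sigma> 0) = mat 1"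
    using whiten_congruence[OF A, of "mat 1"] by (simp add: \<sigma>_def start)
  ultimately have "whiten A (\<sigma> 1) = matrix_exp G" by simp
  then have "\<sigma> 1 = A ** matrix_exp G ** transpose A"
    using congruence_whiten[OF A, of "\<sigma> 1"] by simp
  then show "\<gamma> 1 = (\<mu>, A ** matrix_exp G ** transpose A)"
    using f0[of 1] by (simp add: prod_eq_iff \<sigma>_def)
qed

section \<open>The two updates agree\<close>

theorem proposition47:
  fixes f :: "real^'d \<Rightarrow> real" and w :: "real \<Rightarrow> real" and N :: nat and x :: "nat \<Rightarrow> real^'d"
    and \<mu> \<mu>' :: "real^'d" and A A' \<Sigma> :: "real^'d^'d" and \<delta>t\<mu> \<delta>t\<Sigma> :: real
  assumes "N \<ge> 1"
    and "antimono_on {0..1} w"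
    and "strict_mono_on {1..N} (\<lambda>i. f (x i))"
    and "invertible A"
    and "\<Sigma> = A ** transpose A"
    and "(\<mu>', A') = xnes_step N (selection_weight f w N x) x \<delta>t\<mu> \<delta>t\<Sigma> (\<mu>, A)"
  shows "gaussian_blockwise_gigo f w N x \<delta>t\<mu> \<delta>t\<Sigma> (\<mu>, \<Sigma>) \<in> UNIV \<times> spd_matrices \<and>
         gaussian (gaussian_blockwise_gigo f w N x \<delta>t\<mu> \<delta>t\<Sigma> (\<mu>, \<Sigma>)) = gaussian (\<mu>', A' ** transpose A')"
proof -
  note A = assms(4)
  let ?\<omega> = "selection_weight f w N x"
  define z where "z = (\<lambda>i. matrix_inv A *v (x i - \<mu>))"
  define G where "G = (\<Sum>i=1..N. ?\<omega> i *\<^sub>R z i)"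
  define M where "M = (\<Sum>i=1..N. ?\<omega> i *\<^sub>R ((\<chi> j k. z i $ j * z i $ k) - mat 1))"
  have \<mu>': "\<mu>' = \<mu> + \<delta>t\<mu> *\<^sub>R (A *v G)" and A': "A' = A ** matrix_exp ((\<delta>t\<Sigma> / 2) *\<^sub>R M)"
    using assms(6) by (simp_all add: xnes_step_def Let_def z_def G_def M_def)
  have grad: "natural_gradient gaussian_density (UNIV \<times> sym_matrices) N ?\<omega> x (\<mu>, A ** transpose A) =
      (A *v G, A ** M ** transpose A)" and M_sym: "transpose M = M"
    unfolding G_def M_def z_def by (rule natural_gradient_gaussian[OF A])+
  have "invertible (A ** transpose A)"
    using A by (simp add: invertible_mult transpose_invertible)
  note mean = riemannian_exp_mean[OF this]
  have scaled: "\<delta>t\<Sigma> *\<^sub>R (A ** M ** transpose A) = A ** (\<delta>t\<Sigma> *\<^sub>R M) ** transpose A"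
    by (simp add: matrix_mult_simps)
  have "transpose (\<delta>t\<Sigma> *\<^sub>R M) = \<delta>t\<Sigma> *\<^sub>R M" by (simp add: transpose_scalar M_sym)
  note cov = riemannian_exp_cov[OF A this]
  have "gaussian_blockwise_gigo f w N x \<delta>t\<mu> \<delta>t\<Sigma> (\<mu>, \<Sigma>) =
      (\<mu> + \<delta>t\<mu> *\<^sub>R (A *v G), A ** matrix_exp (\<delta>t\<Sigma> *\<^sub>R M) ** transpose A)"
    by (simp add: gaussian_blockwise_gigo_def blockwise_gigo_def assms(5) grad scaled mean cov)
  (* Symmetry of M: the full exponential is the Gram matrix of the half exponential. *)
  also have "A ** matrix_exp (\<delta>t\<Sigma> *\<^sub>R M) ** transpose A = A' ** transpose A'"
    by (simp only: A' matrix_transpose_mul matrix_mul_assoc flip: matrix_exp_symmetric_square[OF M_sym, of \<delta>t\<Sigma>])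
  finally have gigo: "gaussian_blockwise_gigo f w N x \<delta>t\<mu> \<delta>t\<Sigma> (\<mu>, \<Sigma>) = (\<mu>', A' ** transpose A')"
    by (simp only: \<mu>')
  have "invertible A'"
    unfolding A' by (intro invertible_mult A invertible_matrix_exp)
  then have "A' ** transpose A' \<in> spd_matrices" by (rule spd_matrices_congruence)
  with gigo show ?thesis by simp
qed

end
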